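(* Let $\Delta\subset\mathbb{R}^2$ be a non-empty minimal lattice polygon with $\operatorname{lw}(\Delta)=d$. Then $\Delta$ is unimodularly equivalent to a minimal polygon of one of the following forms: (T1) $\operatorname{conv}\{(0,0),(d,y),(x,d)\}$ where $x,y\in\{0,\ldots,d\}$ satisfy $x+y\le d$; (T2) $\operatorname{conv}\{(x_1,0),(d,y_2),(x_2,d),(0,y_1)\}$ where $x_1,x_2,y_1,y_2\in\{1,\ldots,d-1\}$ satisfy $\max(x_2,y_2)\ge\min(x_1,y_1)$ and $\max(d-x_2,y_1)\ge\min(d-x_1,y_2)$; (T3) $\operatorname{conv}\{(0,0),(\ell,0),(d,y+d-\ell),(x+\ell,d),(z,z+d-\ell)\}$ with $\ell\in\{2,\ldots,d-2\}$, $x\in\{1,\ldots,d-\ell-1\}$, $y,z\in\{1,\ldots,\ell-1\}$; (T4) $\operatorname{conv}\{(0,0),(z'+\ell,z'),(d,y+d-\ell),(x+\ell,d),(z,z+d-\ell)\}$ with $\ell\in\{2,\ldots,d-2\}$, $y,z\in\{1,\ldots,\ell-1\}$, $x,z'\in\{1,\ldots,d-\ell-1\}$; (T5) $\operatorname{conv}\{(x_1,0),(z_2+\ell,z_2),(d,d-\ell+y_2),(x_2+\ell,d),(z_1,z_1+d-\ell),(0,y_1)\}$ with $\ell\in\{2,\ldots,d-2\}$, $x_1,y_2,z_1\in\{1,\ldots,\ell-1\}$, $x_2,y_1,z_2\in\{1,\ldots,d-\ell-1\}$.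
   Context: A lattice polygon is the convex hull of a finite non-empty set of points of $\mathbb{Z}^2$. For a lattice polygon $\Delta$ and a non-zero primitive $v\in\mathbb{Z}^2$, $\operatorname{lw}_v(\Delta)=\max_{Q\in\Delta}\langle Q,v\rangle-\min_{Q\in\Delta}\langle Q,v\rangle$, and the lattice width is $\operatorname{lw}(\Delta)=\min_v\operatorname{lw}_v(\Delta)$ over all non-zero primitive $v\in\mathbb{Z}^2$. A lattice polygon $\Delta$ is minimal if $\operatorname{lw}(\Delta')<\operatorname{lw}(\Delta)$ for every lattice polygon $\Delta'\subsetneq\Delta$. Two lattice polygons are (unimodularly) equivalent if one is the image of the other under a map $x\mapsto Ax+b$ with $A\in\mathrm{GL}_2(\mathbb{Z})$, $b\in\mathbb{Z}^2$. *)

theory Defs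
  imports "HOL-Analysis.Analysis"
begin

definition pt :: "int \<Rightarrow> int \<Rightarrow> real \<times> real" where
  "pt a b = (real_of_int a, real_of_int b)"

definition lattice_polygon :: "(real \<times> real) set \<Rightarrow> bool" where
  "lattice_polygon P \<longleftrightarrow>
     (\<exists>S :: (int \<times> int) set. finite S \<and> S \<noteq> {} \<and>
        P = convex hull ((\<lambda>(a, b). pt a b) ` S))"

definition primitive :: "int \<times> int \<Rightarrow> bool" where
  "primitive v \<longleftrightarrow> v \<noteq> (0, 0) \<and> gcd (fst v) (snd v) = 1"

definition lw_dir :: "(real \<times> real) set \<Rightarrow> int \<times> int \<Rightarrow> real" where
  "lw_dir P v =
     (SUP q\<in>P. fst q * of_int (fst v) + snd q * of_int (snd v)) -
     (INF q\<in>P. fst q * of_int (fst v) + snd q * of_int (snd v))"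

definition lw :: "(real \<times> real) set \<Rightarrow> real" where
  "lw P = (INF v\<in>{v. primitive v}. lw_dir P v)"

definition minimal_polygon :: "(real \<times> real) set \<Rightarrow> bool" where
  "minimal_polygon P \<longleftrightarrow> lattice_polygon P \<and>
     (\<forall>P'. lattice_polygon P' \<and> P' \<subset> P \<longrightarrow> lw P' < lw P)"

definition unimod_map :: "int \<Rightarrow> int \<Rightarrow> int \<Rightarrow> int \<Rightarrow> int \<Rightarrow> int \<Rightarrow> real \<times> real \<Rightarrow> real \<times> real" where
  "unimod_map a11 a12 a21 a22 b1 b2 q =
     (of_int a11 * fst q + of_int a12 * snd q + of_int b1,
      of_int a21 * fst q + of_int a22 * snd q + of_int b2)"

definition unimod_equiv :: "(real \<times> real) set \<Rightarrow> (real \<times> real) set \<Rightarrow> bool" where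
  "unimod_equiv P Q \<longleftrightarrow>
     (\<exists>a11 a12 a21 a22 b1 b2. \<bar>a11 * a22 - a12 * a21\<bar> = 1 \<and>
        Q = unimod_map a11 a12 a21 a22 b1 b2 ` P)"

end

theory Submission
  imports Defs
begin

text \<open>
  Let \<open>V\<close> be the vertex set of a minimal polygon of width \<open>d \<ge> 1\<close>. Deleting a vertex \<open>r\<close> from the lattice
  points of the polygon lowers the width, so some direction has \<open>r\<close> as its unique minimum; a
  subtractive Euclidean descent improves it to a direction in which moreover all other vertices have
  distance between 1 and \<open>d\<close> from \<open>r\<close>. Hence every vertex is the unique minimum of a direction of width
  exactly \<open>d\<close>. Two such directions can be rounded to a basis of the dual lattice, so that \<open>V\<close> lies in
  \<open>[0, d]\<^sup>2\<close> and touches all four sides. The remaining directions of width \<open>d\<close> are then, up to a diamond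
  of type (T2), diagonal. If every vertex owns a side of the square we get (T1) or (T2); otherwise \<open>V\<close>
  lies on the boundary of a hexagon cut out by three directions, and distinguishing which corners of the
  hexagon are vertices leaves (T3), (T4), (T5) or the square case for another pair of directions.
\<close>

section \<open>Directions and unimodular equivalence\<close>

text \<open>Minimality by itself only provides a direction in which the other lattice points spread
  over at most \<open>d - 1\<close> and the vertex lies strictly beyond them, possibly far beyond;
  such a direction need not be thin. The descent replaces it by one that keeps the vertex within
  \<open>d\<close> of everything. The gain is that every vertex becomes the sole point on one side
  of a strip of width exactly \<open>d\<close>, so each side of a thin strip accounts for at most
  one vertex, and thin directions are few: if a set in the square has a thin direction with an entry
  beyond 1 in absolute value, that direction is (2, 1) up to symmetry, and the set is the diamond
  written in another basis. The classification itself is pure integer arithmetic on vertex sets,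
  since \<open>minimal_config\<close> survives unimodular maps. Convex hulls, real widths and
  lattice points other than vertices occur only where \<open>minimal_config\<close> is derived and
  where the result is carried back to polygons. Width 0 is treated apart, as a degenerate
  (T1).\<close>

definition ev :: "int \<Rightarrow> int \<Rightarrow> int \<times> int \<Rightarrow> int" where
  "ev a b p = a * fst p + b * snd p"

definition thin :: "int \<Rightarrow> (int \<times> int) set \<Rightarrow> int \<Rightarrow> int \<Rightarrow> bool" where
  "thin d V a b \<longleftrightarrow> (\<forall>p\<in>V. \<forall>q\<in>V. ev a b p - ev a b q \<le> d)"

text \<open>Admitting all non-zero directions instead of primitive ones changes nothing for
  \<open>d \<ge> 0\<close>, because multiples only enlarge widths, and it lets wideness pull back
  along unimodular maps without a gcd argument.\<close>

definition wide :: "int \<Rightarrow> (int \<times> int) set \<Rightarrow> bool" where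
  "wide d V \<longleftrightarrow> (\<forall>a b. (a, b) \<noteq> (0, 0) \<longrightarrow> (\<exists>p\<in>V. \<exists>q\<in>V. d \<le> ev a b p - ev a b q))"

text \<open>The upper bound matters as much as the strict one: it makes an exposing direction thin,
  so that on a wide set a non-zero one has width exactly \<open>d\<close>.\<close>

definition exposes :: "int \<Rightarrow> (int \<times> int) set \<Rightarrow> int \<Rightarrow> int \<Rightarrow> int \<times> int \<Rightarrow> bool" where
  "exposes d V a b r \<longleftrightarrow>
     (\<forall>p\<in>V. p \<noteq> r \<longrightarrow> ev a b r < ev a b p \<and> ev a b p \<le> ev a b r + d)"

text \<open>The combinatorial trace of minimality on the vertex set \<open>V\<close>.\<close>

definition minimal_config :: "int \<Rightarrow> (int \<times> int) set \<Rightarrow> bool" where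
  "minimal_config d V \<longleftrightarrow> 1 \<le> d \<and> wide d V \<and> (\<forall>r\<in>V. \<exists>a b. exposes d V a b r)"

definition aff :: "int \<Rightarrow> int \<Rightarrow> int \<Rightarrow> int \<Rightarrow> int \<Rightarrow> int \<Rightarrow> int \<times> int \<Rightarrow> int \<times> int" where
  "aff a b c e s t p = (ev a b p + s, ev c e p + t)"

definition affine_equiv :: "(int \<times> int) set \<Rightarrow> (int \<times> int) set \<Rightarrow> bool" where
  "affine_equiv V W \<longleftrightarrow> (\<exists>a b c e s t. \<bar>a * e - b * c\<bar> = 1 \<and> W = aff a b c e s t ` V)"

definition normal_form :: "int \<Rightarrow> (int \<times> int) set \<Rightarrow> bool" where
  "normal_form d W \<longleftrightarrow>
    (\<exists>x y. 0 \<le> x \<and> x \<le> d \<and> 0 \<le> y \<and> y \<le> d \<and> x + y \<le> d \<and> W = {(0, 0), (d, y), (x, d)})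
   \<or> (\<exists>x1 x2 y1 y2. x1 \<in> {1..d-1} \<and> x2 \<in> {1..d-1} \<and> y1 \<in> {1..d-1} \<and> y2 \<in> {1..d-1} \<and>
        max x2 y2 \<ge> min x1 y1 \<and> max (d - x2) y1 \<ge> min (d - x1) y2 \<and>
        W = {(x1, 0), (d, y2), (x2, d), (0, y1)})
   \<or> (\<exists>l x y z. l \<in> {2..d-2} \<and> x \<in> {1..d-l-1} \<and> y \<in> {1..l-1} \<and> z \<in> {1..l-1} \<and>
        W = {(0, 0), (l, 0), (d, y + d - l), (x + l, d), (z, z + d - l)})
   \<or> (\<exists>l x y z z'. l \<in> {2..d-2} \<and> y \<in> {1..l-1} \<and> z \<in> {1..l-1} \<and>
        x \<in> {1..d-l-1} \<and> z' \<in> {1..d-l-1} \<and>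
        W = {(0, 0), (z' + l, z'), (d, y + d - l), (x + l, d), (z, z + d - l)})
   \<or> (\<exists>l x1 x2 y1 y2 z1 z2. l \<in> {2..d-2} \<and>
        x1 \<in> {1..l-1} \<and> y2 \<in> {1..l-1} \<and> z1 \<in> {1..l-1} \<and>
        x2 \<in> {1..d-l-1} \<and> y1 \<in> {1..d-l-1} \<and> z2 \<in> {1..d-l-1} \<and>
        W = {(x1, 0), (z2 + l, z2), (d, d - l + y2), (x2 + l, d), (z1, z1 + d - l), (0, y1)})"

definition classifiable :: "int \<Rightarrow> (int \<times> int) set \<Rightarrow> bool" where
  "classifiable d V \<longleftrightarrow> (\<exists>W. affine_equiv V W \<and> normal_form d W)"

definition in_square :: "int \<Rightarrow> (int \<times> int) set \<Rightarrow> bool" where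
  "in_square d W \<longleftrightarrow> (\<forall>p\<in>W. 0 \<le> fst p \<and> fst p \<le> d \<and> 0 \<le> snd p \<and> snd p \<le> d)"

section \<open>Invariance under unimodular affine maps\<close>

lemma ev_aff: "ev u v (aff a b c e s t p) = ev (u * a + v * c) (u * b + v * e) p + (u * s + v * t)"
  by (simp add: ev_def aff_def algebra_simps)

lemma abs_eq_one_int: "\<bar>x :: int\<bar> = 1 \<longleftrightarrow> x = 1 \<or> x = -1"
  by auto

lemma unimodular_pullback_nonzero:
  fixes a b c e u v :: int
  assumes "\<bar>a * e - b * c\<bar> = 1" "u * a + v * c = 0" "u * b + v * e = 0"
  shows "u = 0 \<and> v = 0"
proof -
  have "u * (a * e - b * c) = e * (u * a + v * c) - c * (u * b + v * e)"
    "v * (a * e - b * c) = a * (u * b + v * e) - b * (u * a + v * c)"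
    by algebra+
  then have "u * (a * e - b * c) = 0" "v * (a * e - b * c) = 0"
    unfolding assms(2,3) by simp_all
  moreover have "a * e - b * c \<noteq> 0" using assms(1) by linarith
  ultimately show ?thesis by (metis mult_eq_0_iff)
qed

lemma unimodular_pushforward:
  fixes a b c e x y :: int
  assumes "\<bar>a * e - b * c\<bar> = 1"
  obtains u v where "u * a + v * c = x" "u * b + v * e = y"
proof -
  define D where "D = a * e - b * c"
  have DD: "D * D = 1" using assms unfolding D_def[symmetric] abs_eq_one_int by auto
  have "(D * (x * e - y * c)) * a + (D * (y * a - x * b)) * c = D * D * x"
    "(D * (x * e - y * c)) * b + (D * (y * a - x * b)) * e = D * D * y"
    unfolding D_def by algebra+
  then show ?thesis using that unfolding DD mult_1 by blast
qed

lemma inj_aff: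
  assumes "\<bar>a * e - b * c\<bar> = 1"
  shows "inj (aff a b c e s t)"
proof (rule injI)
  fix p q assume "aff a b c e s t p = aff a b c e s t q"
  then have "(fst p - fst q) * a + (snd p - snd q) * b = 0" 
     "(fst p - fst q) * c + (snd p - snd q) * e = 0"
    by (simp_all add: aff_def ev_def algebra_simps)
  moreover have "\<bar>a * e - c * b\<bar> = 1" using assms by (simp add: mult.commute)
  ultimately have "fst p - fst q = 0 \<and> snd p - snd q = 0"
    by (intro unimodular_pullback_nonzero[of a e c b]) 
  then show "p = q" by (simp add: prod_eq_iff)
qed

lemma thin_aff:
  "thin d (aff a b c e s t ` V) u v \<longleftrightarrow> thin d V (u * a + v * c) (u * b + v * e)"
  by (simp add: thin_def ev_aff)

lemma exposes_aff:
  assumes "\<bar>a * e - b * c\<bar> = 1"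
  shows "exposes d (aff a b c e s t ` V) u v (aff a b c e s t r)
    \<longleftrightarrow> exposes d V (u * a + v * c) (u * b + v * e) r"
  using inj_aff[OF assms] by (simp add: exposes_def ev_aff inj_eq algebra_simps)

lemma minimal_config_aff:
  assumes D: "\<bar>a * e - b * c\<bar> = 1" and V: "minimal_config d V"
  shows "minimal_config d (aff a b c e s t ` V)"
proof -
  have "wide d (aff a b c e s t ` V)"
    unfolding wide_def
  proof (intro allI impI)
    fix u v :: int assume "(u, v) \<noteq> (0, 0)"
    then have "(u * a + v * c, u * b + v * e) \<noteq> (0, 0)"
      using unimodular_pullback_nonzero[OF D, of u v] by blast
    then obtain p q where "p \<in> V" "q \<in> V"
      "d \<le> ev (u * a + v * c) (u * b + v * e) p - ev (u * a + v * c) (u * b + v * e) q"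
      using V unfolding minimal_config_def wide_def by blast
    then show "\<exists>p\<in>aff a b c e s t ` V. \<exists>q\<in>aff a b c e s t ` V. d \<le> ev u v p - ev u v q"
      by (auto simp: ev_aff)
  qed
  moreover have "\<exists>u v. exposes d (aff a b c e s t ` V) u v r" if r: "r \<in> aff a b c e s t ` V" for r
  proof -
    obtain r' where r': "r' \<in> V" "r = aff a b c e s t r'" using r by blast
    obtain x y where xy: "exposes d V x y r'" using V r' unfolding minimal_config_def by blast
    obtain u v where "u * a + v * c = x" "u * b + v * e = y" using unimodular_pushforward[OF D] .
    then show ?thesis using xy r' exposes_aff[OF D] by metis
  qed
  ultimately show ?thesis using V unfolding minimal_config_def by blast
qed

lemma affine_equiv_trans:
  assumes "affine_equiv U V" "affine_equiv V W"
  shows "affine_equiv U W"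
proof -
  obtain a b c e s t a' b' c' e' s' t' where
    D: "\<bar>a * e - b * c\<bar> = 1" "V = aff a b c e s t ` U" and
    D': "\<bar>a' * e' - b' * c'\<bar> = 1" "W = aff a' b' c' e' s' t' ` V"
    using assms unfolding affine_equiv_def by auto
  have "(a' * a + b' * c) * (c' * b + e' * e) - (a' * b + b' * e) * (c' * a + e' * c)
    = (a' * e' - b' * c') * (a * e - b * c)" by algebra
  then have "\<bar>(a' * a + b' * c) * (c' * b + e' * e) - (a' * b + b' * e) * (c' * a + e' * c)\<bar> = 1"
    using D D' by (simp add: abs_mult)
  moreover have "W = aff (a' * a + b' * c) (a' * b + b' * e) (c' * a + e' * c) (c' * b + e' * e)
      (a' * s + b' * t + s') (c' * s + e' * t + t') ` U"
    unfolding D'(2) D(2) image_image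
    by (rule image_cong) (auto simp: aff_def ev_def algebra_simps)
  ultimately show ?thesis unfolding affine_equiv_def by blast
qed

lemma affine_equiv_aff: "\<bar>a * e - b * c\<bar> = 1 \<Longrightarrow> affine_equiv V (aff a b c e s t ` V)"
  unfolding affine_equiv_def by blast

lemma classifiable_affine_equiv: "affine_equiv V W \<Longrightarrow> classifiable d W \<Longrightarrow> classifiable d V"
  unfolding classifiable_def using affine_equiv_trans by blast

lemma classifiable_aff: "\<bar>a * e - b * c\<bar> = 1 \<Longrightarrow> classifiable d (aff a b c e s t ` V) \<Longrightarrow> classifiable d V"
  using classifiable_affine_equiv affine_equiv_aff by blast

lemma normal_form_imp_classifiable: "normal_form d V \<Longrightarrow> classifiable d V"
proof -
  assume f: "normal_form d V"
  have "V = aff 1 0 0 1 0 0 ` V" by (simp add: aff_def ev_def)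
  then have "affine_equiv V V" unfolding affine_equiv_def
      by (metis abs_one diff_zero mult_1 mult_zero_left)
  with f show ?thesis unfolding classifiable_def by blast
qed

section \<open>Thin directions of a minimal configuration\<close>

lemma thin_range:
  assumes "minimal_config d V" "thin d V a b" "(a, b) \<noteq> (0, 0)"
  obtains m where "\<And>p. p \<in> V \<Longrightarrow> m \<le> ev a b p \<and> ev a b p \<le> m + d"
    "\<exists>p\<in>V. ev a b p = m" "\<exists>p\<in>V. ev a b p = m + d"
proof -
  obtain p q where pq: "p \<in> V" "q \<in> V" "d \<le> ev a b p - ev a b q"
    using assms unfolding minimal_config_def wide_def by blast
  have "\<And>p q. p \<in> V \<Longrightarrow> q \<in> V \<Longrightarrow> ev a b p - ev a b q \<le> d"
    using assms unfolding thin_def by blast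
  then show ?thesis using pq
    by (intro that[of "ev a b q"]) (smt (verit))+
qed

lemma exposes_thin: "0 \<le> d \<Longrightarrow> exposes d V a b r \<Longrightarrow> r \<in> V \<Longrightarrow> thin d V a b"
  unfolding exposes_def thin_def by (smt (verit))

text \<open>The zero direction could expose only the point of a singleton, which wideness with
  \<open>d \<ge> 1\<close> excludes.\<close>

lemma exposes_nonzero:
  assumes "minimal_config d V" "r \<in> V" "exposes d V a b r"
  shows "(a, b) \<noteq> (0, 0)"
proof
  assume ab: "(a, b) = (0, 0)"
  obtain p q where pq: "p \<in> V" "q \<in> V" "d \<le> ev 1 0 p - ev 1 0 q"
    using assms unfolding minimal_config_def wide_def by (metis prod.inject zero_neq_one)
  then have "p \<noteq> q" using assms by (auto simp: minimal_config_def)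
  then obtain p' where "p' \<in> V" "p' \<noteq> r" using pq by metis
  then show False using assms(3) ab by (auto simp: exposes_def ev_def)
qed

text \<open>Dividing by \<open>k\<close> leaves a non-zero direction of width at least
  \<open>d\<close>, so the given one has width at least \<open>\<bar>k\<bar> * d\<close>.\<close>

lemma thin_primitive:
  assumes "minimal_config d V" "thin d V (k * a) (k * b)" "(k * a, k * b) \<noteq> (0, 0)"
  shows "\<bar>k\<bar> = 1"
proof -
  have "(a, b) \<noteq> (0, 0)" and k0: "k \<noteq> 0" using assms(3) by auto
  then obtain p q where pq: "p \<in> V" "q \<in> V" "d \<le> ev a b p - ev a b q"
    using assms(1) unfolding minimal_config_def wide_def by blast
  have ev: "ev (k * a) (k * b) r = k * ev a b r" for r by (simp add: ev_def algebra_simps)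
  have "k * (ev a b p - ev a b q) \<le> d" "k * (ev a b q - ev a b p) \<le> d"
    using assms(2) pq unfolding thin_def ev by (auto simp: right_diff_distrib)
  then have "\<bar>k\<bar> * (ev a b p - ev a b q) \<le> d"
    by (auto simp: abs_if algebra_simps)
  moreover have "\<bar>k\<bar> * d \<le> \<bar>k\<bar> * (ev a b p - ev a b q)" using pq by (intro mult_left_mono) auto
  ultimately have "\<bar>k\<bar> * d \<le> 1 * d" by simp
  then have "\<bar>k\<bar> \<le> 1" using assms(1) by (simp add: minimal_config_def)
  then show ?thesis using k0 by auto
qed

section \<open>A basis of thin directions\<close>

lemma thin_uminus: "thin d V (- a) (- b) \<longleftrightarrow> thin d V a b"
  unfolding thin_def ev_def by (smt (verit) mult_minus_left)

text \<open>On two points alone, the direction orthogonal to their difference would have width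
  0.\<close>

lemma minimal_config_third_point:
  assumes "minimal_config d V" "p \<in> V" "q \<in> V" "p \<noteq> q"
  obtains r where "r \<in> V" "r \<noteq> p" "r \<noteq> q"
proof (rule ccontr)
  assume "\<not> thesis"
  then have V: "V = {p, q}" using that assms by blast
  have "(snd q - snd p, fst p - fst q) \<noteq> (0, 0)" using assms(4) by (auto simp: prod_eq_iff)
  then obtain x y where xy: "x \<in> V" "y \<in> V"
    "d \<le> ev (snd q - snd p) (fst p - fst q) x - ev (snd q - snd p) (fst p - fst q) y"
    using assms(1) unfolding minimal_config_def wide_def by blast
  have "ev (snd q - snd p) (fst p - fst q) p = ev (snd q - snd p) (fst p - fst q) q"
    by (simp add: ev_def algebra_simps)
  then have "d \<le> 0" using xy V by auto
  then show False using assms(1) by (simp add: minimal_config_def)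
qed

text \<open>Parallel directions order points alike or in reverse, so the middle one of three is
  never strictly below both others. Comparing products of differences through the squared lengths of
  the directions avoids dividing by \<open>a\<close> or \<open>b\<close>, either of which may
  vanish.\<close>

lemma parallel_not_between:
  fixes a b g1 g2 :: int
  assumes "a * g2 - b * g1 = 0" "(a, b) \<noteq> (0, 0)"
    and "ev a b p < ev a b r" "ev a b r \<le> ev a b s"
    and "ev g1 g2 r < ev g1 g2 p" "ev g1 g2 r < ev g1 g2 s"
  shows False
proof -
  have 1: "a * (ev g1 g2 x - ev g1 g2 y) = g1 * (ev a b x - ev a b y)" for x y
  proof -
    have "a * (ev g1 g2 x - ev g1 g2 y) = g1 * (ev a b x - ev a b y) + (a * g2 - b * g1) * (snd x - snd y)"
      by (simp add: ev_def algebra_simps)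
    then show ?thesis using assms(1) by simp
  qed
  have 2: "b * (ev g1 g2 x - ev g1 g2 y) = g2 * (ev a b x - ev a b y)" for x y
  proof -
    have "b * (ev g1 g2 x - ev g1 g2 y) = g2 * (ev a b x - ev a b y) - (a * g2 - b * g1) * (fst x - fst y)"
      by (simp add: ev_def algebra_simps)
    then show ?thesis using assms(1) by simp
  qed
  let ?G = "(ev g1 g2 p - ev g1 g2 r) * (ev g1 g2 s - ev g1 g2 r)"
  let ?F = "(ev a b p - ev a b r) * (ev a b s - ev a b r)"
  have "(a * a + b * b) * ?G = (a * (ev g1 g2 p - ev g1 g2 r)) * (a * (ev g1 g2 s - ev g1 g2 r))
    + (b * (ev g1 g2 p - ev g1 g2 r)) * (b * (ev g1 g2 s - ev g1 g2 r))" by algebra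
  also have "\<dots> = (g1 * g1 + g2 * g2) * ?F" unfolding 1 2 by algebra
  finally have eq: "(a * a + b * b) * ?G = (g1 * g1 + g2 * g2) * ?F" .
  have "?F \<le> 0" using assms by (intro mult_nonpos_nonneg) auto
  then have "(g1 * g1 + g2 * g2) * ?F \<le> 0"
    using mult_nonneg_nonpos[of "g1 * g1 + g2 * g2" ?F] by simp
  moreover have "0 < ?G" using assms by (intro mult_pos_pos) auto
  moreover have "0 < a * a + b * b" using assms(2) by (auto simp: sum_squares_gt_zero_iff)
  ultimately show False using eq by (metis mult_pos_pos not_le)
qed

text \<open>Expose \<open>p\<close>, and of two further points take the one that comes first in that
  direction. It lies between \<open>p\<close> and the other one, so a direction exposing it is not
  parallel to the first.\<close>

lemma thin_independent:
  assumes "minimal_config d V"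
  obtains a b c e where "thin d V a b" "thin d V c e" "a * e - b * c \<noteq> 0"
proof -
  have d: "0 \<le> d" using assms by (simp add: minimal_config_def)
  obtain p q where pq: "p \<in> V" "q \<in> V" "d \<le> ev 1 0 p - ev 1 0 q"
    using assms unfolding minimal_config_def wide_def by (metis prod.inject zero_neq_one)
  then have "p \<noteq> q" using assms by (auto simp: minimal_config_def)
  then obtain r where r: "r \<in> V" "r \<noteq> p" "r \<noteq> q" using minimal_config_third_point[OF assms] pq by metis
  obtain a b where ab: "exposes d V a b p" using assms pq unfolding minimal_config_def by blast
  have ab0: "(a, b) \<noteq> (0, 0)" using exposes_nonzero[OF assms _ ab] pq by blast
  have key: "\<exists>c e. thin d V c e \<and> a * e - b * c \<noteq> 0" if xy: "x \<in> V" "y \<in> V" "x \<noteq> p" "y \<noteq> p" "x \<noteq> y"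
      "ev a b x \<le> ev a b y" for x y
  proof -
    obtain c e where ce: "exposes d V c e x" using assms xy unfolding minimal_config_def by blast
    have "a * e - b * c \<noteq> 0"
    proof
      assume "a * e - b * c = 0"
      moreover have "ev a b p < ev a b x" using ab xy by (auto simp: exposes_def)
      moreover have "ev c e x < ev c e p" "ev c e x < ev c e y" using ce xy pq
          by (auto simp: exposes_def)
      ultimately show False using parallel_not_between ab0 xy by blast
    qed
    then show ?thesis using exposes_thin[OF d ce] xy by blast
  qed
  have "\<exists>c e. thin d V c e \<and> a * e - b * c \<noteq> 0"
    using key[of q r] key[of r q] r pq \<open>p \<noteq> q\<close> by (metis linear)
  then show thesis using that exposes_thin[OF d ab] pq by blast
qed

text \<open>Rounding: if \<open>f\<close> and \<open>g\<close> are thin of index \<open>D \<ge> 2\<close>, and \<open>(f, w)\<close> is a basis of the dual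
  lattice, then some \<open>h = w + k f\<close> equals \<open>(g + t f) / D\<close> with \<open>\<bar>t\<bar> \<le> D / 2\<close>, which is thin too.\<close>

lemma thin_basis:
  assumes V: "minimal_config d V"
  obtains a b c e where "thin d V a b" "thin d V c e" "\<bar>a * e - b * c\<bar> = 1"
proof -
  obtain a b g1' g2' where ab: "thin d V a b" and g': "thin d V g1' g2'" and D0: "a * g2' - b * g1' \<noteq> 0"
    using thin_independent[OF V] .
  obtain g1 g2 where g: "thin d V g1 g2" and D1: "0 < a * g2 - b * g1"
  proof (cases "0 < a * g2' - b * g1'")
    case False
    then show ?thesis using D0 g' that[of "- g1'" "- g2'"] by (simp add: thin_uminus)
  qed (use g' that in blast)
  have d: "1 \<le> d" using V by (simp add: minimal_config_def)
  define D where "D = a * g2 - b * g1"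
  have "\<bar>gcd a b\<bar> = 1"
  proof (rule thin_primitive[OF V])
    show "thin d V (gcd a b * (a div gcd a b)) (gcd a b * (b div gcd a b))" using ab by simp
    have "(a, b) \<noteq> (0, 0)" using D1 by auto
    then show "(gcd a b * (a div gcd a b), gcd a b * (b div gcd a b)) \<noteq> (0, 0)" by simp
  qed
  then have "gcd a b = 1" by simp
  then obtain u v where "u * a + v * b = 1" using bezout_int[of a b] by auto
  define e c where "e = u" and "c = - v"
  have det: "a * e - b * c = 1" using \<open>u * a + v * b = 1\<close> by (simp add: e_def c_def algebra_simps)
  \<comment> \<open>\<open>P\<close> and \<open>D\<close> are the coordinates of \<open>g\<close> in
    the dual basis formed by \<open>(a, b)\<close> and \<open>(c, e)\<close>.\<close>
  define P where "P = g1 * e - g2 * c"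
  have "g1 * (a * e - b * c) = P * a + D * c" "g2 * (a * e - b * c) = P * b + D * e"
    unfolding P_def D_def by algebra+
  then have gP: "g1 = P * a + D * c" "g2 = P * b + D * e" unfolding det by simp_all
  show thesis
  proof (cases "D = 1")
    case True
    then show thesis using that[OF ab g] by (simp add: D_def)
  next
    case False
    then have D2: "2 \<le> D" using D1 D_def by linarith
    \<comment> \<open>\<open>k\<close> is \<open>P / D\<close> rounded to a nearest integer, whence
      the bound on \<open>t\<close>.\<close>
    define k where "k = (2 * P + D) div (2 * D)"
    define t where "t = k * D - P"
    have "2 * P + D = 2 * D * k + (2 * P + D) mod (2 * D)" unfolding k_def by simp
    moreover have "0 \<le> (2 * P + D) mod (2 * D)" "(2 * P + D) mod (2 * D) < 2 * D" using D2 by auto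
    ultimately have t: "2 * \<bar>t\<bar> \<le> D" unfolding t_def by (simp add: algebra_simps abs_if)
    have Dh: "D * ev (c + k * a) (e + k * b) p = ev g1 g2 p + t * ev a b p" for p
      unfolding ev_def gP t_def by algebra
    have "thin d V (c + k * a) (e + k * b)"
      unfolding thin_def
    proof (intro ballI)
      fix p q assume pq: "p \<in> V" "q \<in> V"
      let ?h = "ev (c + k * a) (e + k * b) p - ev (c + k * a) (e + k * b) q"
      have f: "\<bar>ev a b p - ev a b q\<bar> \<le> d" using ab pq unfolding thin_def by (auto simp: abs_if)
      have "2 * (D * ?h) = 2 * (ev g1 g2 p - ev g1 g2 q) + 2 * (t * (ev a b p - ev a b q))"
        unfolding right_diff_distrib Dh by (simp add: algebra_simps)
      moreover have "ev g1 g2 p - ev g1 g2 q \<le> d" using g pq unfolding thin_def by blast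
      moreover have "2 * (t * (ev a b p - ev a b q)) \<le> D * d"
      proof -
        have "2 * (t * (ev a b p - ev a b q)) \<le> \<bar>2 * t\<bar> * \<bar>ev a b p - ev a b q\<bar>"
          by (metis abs_ge_self abs_mult mult.assoc)
        also have "\<dots> \<le> D * d" using t f D2 by (intro mult_mono) auto
        finally show ?thesis .
      qed
      \<comment> \<open>Here the index being at least 2 enters: twice \<open>D * ?h\<close> is at
        most \<open>2 * d + D * d\<close>, hence at most \<open>2 * D * d\<close>.\<close>
      moreover have "2 * d \<le> D * d" using D2 d by (intro mult_right_mono) auto
      moreover have "X \<le> Z" if "2 * X = 2 * g + Y" "g \<le> d" "Y \<le> Z" "2 * d \<le> Z" for X Y Z g :: int
        using that by linarith
      ultimately have "D * ?h \<le> D * d" by blast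
      then show "?h \<le> d" using D2 by simp
    qed
    moreover have "\<bar>a * (e + k * b) - b * (c + k * a)\<bar> = 1"
    proof -
      have "a * (e + k * b) - b * (c + k * a) = a * e - b * c" by algebra
      then show ?thesis using det by simp
    qed
    ultimately show thesis using that[OF ab] by blast
  qed
qed

section \<open>Squares touched on all four sides\<close>

lemma thin_basis_in_square:
  assumes "minimal_config d V" "thin d V a b" "thin d V c e" "\<bar>a * e - b * c\<bar> = 1"
  obtains s t where "in_square d (aff a b c e s t ` V)"
proof -
  have "(a, b) \<noteq> (0, 0)" "(c, e) \<noteq> (0, 0)" using assms(4) by auto
  then obtain m1 m2 where "\<And>p. p \<in> V \<Longrightarrow> m1 \<le> ev a b p \<and> ev a b p \<le> m1 + d"
    "\<And>p. p \<in> V \<Longrightarrow> m2 \<le> ev c e p \<and> ev c e p \<le> m2 + d"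
    using thin_range[OF assms(1,2)] thin_range[OF assms(1,3)] by metis
  then show thesis using that[of "- m1" "- m2"] by (force simp: in_square_def aff_def)
qed

lemma in_square_sides:
  assumes "minimal_config d W" "in_square d W"
  obtains x1 y2 x2 y1 where "(x1, 0) \<in> W" "(d, y2) \<in> W" "(x2, d) \<in> W" "(0, y1) \<in> W"
proof -
  have w: "\<And>a b. (a, b) \<noteq> (0, 0) \<Longrightarrow> \<exists>p\<in>W. \<exists>q\<in>W. d \<le> ev a b p - ev a b q"
    using assms unfolding minimal_config_def wide_def by blast
  obtain p q where pq: "p \<in> W" "q \<in> W" "d \<le> fst p - fst q" using w[of 1 0] by (auto simp: ev_def)
  obtain r s where rs: "r \<in> W" "s \<in> W" "d \<le> snd r - snd s" using w[of 0 1] by (auto simp: ev_def)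
  have "fst p = d" "fst q = 0" "snd r = d" "snd s = 0"
    using assms(2) pq rs unfolding in_square_def by (smt (verit))+
  then show thesis using that pq rs by (metis prod.collapse)
qed

text \<open>The inequalities between the side points force all four to be midpoints of sides, so
  \<open>d = 2 * x\<close>. Any other point of \<open>W\<close> has l1-distance at most
  \<open>x\<close> from the centre, but exposing it would need a value, relative to the centre,
  below \<open>- x\<close> times the max norm of the direction. Duality of the two norms excludes
  this.\<close>

lemma diamond_classifiable:
  assumes W: "minimal_config d W" "in_square d W" and t1: "thin d W 1 1" and t2: "thin d W 1 (- 1)"
  shows "classifiable d W"
proof -
  obtain x1 y2 x2 y1 where P: "(x1, 0) \<in> W" "(d, y2) \<in> W" "(x2, d) \<in> W" "(0, y1) \<in> W"
    using in_square_sides[OF W] .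
  have d: "1 \<le> d" using W by (simp add: minimal_config_def)
  have t1': "\<And>p q. p \<in> W \<Longrightarrow> q \<in> W \<Longrightarrow> fst p + snd p - (fst q + snd q) \<le> d"
    using t1 by (simp add: thin_def ev_def)
  have t2': "\<And>p q. p \<in> W \<Longrightarrow> q \<in> W \<Longrightarrow> fst p - snd p - (fst q - snd q) \<le> d"
    using t2 by (simp add: thin_def ev_def)
  define x where "x = x1"
  have "y2 \<le> y1" using t1'[OF P(2,4)] by simp
  moreover have "x2 \<le> x1" using t1'[OF P(3,1)] by simp
  moreover have "y2 \<le> x1" using t1'[OF P(2,1)] by simp
  moreover have "x2 \<le> y1" using t1'[OF P(3,4)] by simp
  moreover have "x1 + y1 \<le> d" using t2'[OF P(1,4)] by simp
  moreover have "d \<le> x2 + y2" using t2'[OF P(2,3)] by simp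
  moreover have "x1 \<le> x2" using t2'[OF P(1,3)] by simp
  moreover have "y1 \<le> y2" using t2'[OF P(2,4)] by simp
  ultimately have eq: "x1 = x" "x2 = x" "y1 = x" "y2 = x" "d = 2 * x" by (simp_all add: x_def)
  have sub: "r \<in> {(x, 0), (d, x), (x, d), (0, x)}" if r: "r \<in> W" for r
  proof (rule ccontr)
    assume n: "r \<notin> {(x, 0), (d, x), (x, d), (0, x)}"
    obtain a b where ab: "exposes d W a b r" using W r unfolding minimal_config_def by blast
    obtain s t where st: "r = (x + s, x + t)"
        by (metis add_diff_cancel_left' diff_add_cancel add.commute prod.collapse)
    have "a * s + b * t < - b * x" "a * s + b * t < a * x" "a * s + b * t < b * x"
        "a * s + b * t < - a * x"
      using ab P n unfolding exposes_def st ev_def eq by (fastforce simp: algebra_simps)+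
    then have lt: "a * s + b * t < - (max \<bar>a\<bar> \<bar>b\<bar> * x)" by (auto simp: max_def abs_if)
    have "\<bar>s\<bar> + \<bar>t\<bar> \<le> x"
      using t1'[OF r P(1)] t1'[OF P(2) r] t2'[OF r P(4)] t2'[OF P(1) r] unfolding st eq by simp
    then have "max \<bar>a\<bar> \<bar>b\<bar> * (\<bar>s\<bar> + \<bar>t\<bar>) \<le> max \<bar>a\<bar> \<bar>b\<bar> * x" by (intro mult_left_mono) auto
    moreover have "\<bar>a\<bar> * \<bar>s\<bar> \<le> max \<bar>a\<bar> \<bar>b\<bar> * \<bar>s\<bar>" "\<bar>b\<bar> * \<bar>t\<bar> \<le> max \<bar>a\<bar> \<bar>b\<bar> * \<bar>t\<bar>"
      by (intro mult_right_mono; simp)+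
    ultimately have "\<bar>a * s\<bar> + \<bar>b * t\<bar> \<le> max \<bar>a\<bar> \<bar>b\<bar> * x" by (simp add: abs_mult distrib_left)
    then show False using lt by linarith
  qed
  have "W = {(x, 0), (d, x), (x, d), (0, x)}" using sub P unfolding eq by blast
  then have "normal_form d W" unfolding normal_form_def using eq d
    by (intro disjI2[OF disjI1] exI[of _ x]) auto
  then show ?thesis by (rule normal_form_imp_classifiable)
qed

lemma diamond_basis_classifiable:
  assumes "minimal_config d V" "\<bar>a * e - b * c\<bar> = 1" "thin d V a b" "thin d V c e"
    "thin d V (a + c) (b + e)" "thin d V (a - c) (b - e)"
  shows "classifiable d V"
proof -
  obtain s t where "in_square d (aff a b c e s t ` V)" using thin_basis_in_square assms by metis
  then have "classifiable d (aff a b c e s t ` V)"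
    using assms minimal_config_aff by (intro diamond_classifiable) (auto simp: thin_aff)
  then show ?thesis using classifiable_aff assms by blast
qed

lemma in_square_thin_axes:
  assumes "in_square d W"
  shows "thin d W 1 0" "thin d W 0 1"
  using assms unfolding thin_def in_square_def ev_def by (auto, smt (verit) prod.sel)+

text \<open>Comparing the points on the right and left sides gives \<open>a - b \<le> 1\<close>. If
  \<open>a = b + 1\<close>, the estimate is tight, so \<open>(d, 0)\<close> and
  \<open>(0, d)\<close> belong to \<open>W\<close>, and wideness in direction (1, 1) leaves only (2,
  1).\<close>

lemma in_square_thin_ordered:
  assumes W: "minimal_config d W" "in_square d W" and th: "thin d W a b" and ab: "0 \<le> b" "b \<le> a" "0 < a"
  shows "classifiable d W \<or> a = 1 \<and> b \<le> 1"
proof (cases "b = 0")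
  case True
  then have "\<bar>a\<bar> = 1" using thin_primitive[of d W a 1 0] W th ab by simp
  then show ?thesis using True ab by simp
next
  case False
  then have b1: "1 \<le> b" using ab by simp
  have d: "1 \<le> d" using W by (simp add: minimal_config_def)
  obtain x1 y2 x2 y1 where P: "(x1, 0) \<in> W" "(d, y2) \<in> W" "(x2, d) \<in> W" "(0, y1) \<in> W"
    using in_square_sides[OF W] .
  have t': "\<And>p q. p \<in> W \<Longrightarrow> q \<in> W \<Longrightarrow> a * fst p + b * snd p - (a * fst q + b * snd q) \<le> d"
    using th by (simp add: thin_def ev_def)
  have bd: "0 \<le> y2" "y1 \<le> d" using P W(2) by (auto simp: in_square_def)
  have 1: "a * d + b * (y2 - y1) \<le> d" using t'[OF P(2,4)] by (simp add: algebra_simps)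
  have 2: "b * (- d) \<le> b * (y2 - y1)" using b1 bd by (intro mult_left_mono) auto
  have "(a - b) * d \<le> 1 * d" using 1 2 by (simp add: algebra_simps)
  then have "a - b \<le> 1" using d by simp
  then consider "a = b" | "a = b + 1" using ab by linarith
  then show ?thesis
  proof cases
    case 1
    then have "\<bar>a\<bar> = 1" using thin_primitive[of d W a 1 1] W th ab by simp
    then show ?thesis using 1 ab by simp
  next
    case a: 2
    have "b * (y2 - y1) \<le> b * (- d)" using 1 a by (simp add: algebra_simps)
    then have "y2 - y1 \<le> - d" using b1
        by (meson mult_le_cancel_left_pos zero_less_one order_less_le_trans)
    then have y: "y2 = 0" "y1 = d" using bd by auto
    \<comment> \<open>Adding \<open>snd p \<le> d\<close> and \<open>0 \<le> snd q\<close> to the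
      bounds at the two corners turns the direction \<open>(b + 1, b)\<close> into
      \<open>b + 1\<close> times (1, 1).\<close>
    have diff: "(b + 1) * ((fst p + snd p) - (fst q + snd q)) \<le> 2 * d" if pq: "p \<in> W" "q \<in> W" for p q
    proof -
      have "snd p \<le> d" "0 \<le> snd q" using pq W(2) by (auto simp: in_square_def)
      moreover have "(b + 1) * fst p + b * snd p - b * d \<le> d"
        using t'[OF pq(1) P(4)] y a by simp
      moreover have "(b + 1) * d - ((b + 1) * fst q + b * snd q) \<le> d"
        using t'[OF P(2) pq(2)] y a by simp
      ultimately show ?thesis by (simp add: algebra_simps)
    qed
    obtain p q where pq: "p \<in> W" "q \<in> W" "d \<le> (fst p + snd p) - (fst q + snd q)"
      using W(1) unfolding minimal_config_def wide_def ev_def by (metis mult_1 prod.inject zero_neq_one)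
    have "(b + 1) * d \<le> (b + 1) * ((fst p + snd p) - (fst q + snd q))"
      using pq b1 by (intro mult_left_mono) auto
    also have "\<dots> \<le> 2 * d" using diff pq by blast
    finally have "b + 1 \<le> 2" using d by simp
    then have "b = 1" "a = 2" using b1 a by auto
    moreover have "thin d W 1 1" unfolding thin_def
    proof (intro ballI)
      fix p q assume "p \<in> W" "q \<in> W"
      then show "ev 1 1 p - ev 1 1 q \<le> d" using diff[of p q] \<open>b = 1\<close> by (simp add: ev_def)
    qed
    moreover have "thin d W 1 0" "thin d W 0 1" using in_square_thin_axes[OF W(2)] by auto
    \<comment> \<open>In the basis (1, 0), (1, 1) the sum is (2, 1) and the difference is (0, -1):
      all four directions of a diamond are thin.\<close>
    ultimately have "classifiable d W" using W th
        by (intro diamond_basis_classifiable[of d W 1 0 1 1]) auto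
    then show ?thesis ..
  qed
qed

text \<open>Reflections and a swap of the coordinates reduce to
  \<open>0 \<le> b \<le> a\<close>.\<close>

lemma in_square_thin:
  assumes W: "minimal_config d W" "in_square d W" and th: "thin d W a b" and ab: "(a, b) \<noteq> (0, 0)"
  shows "classifiable d W \<or> \<bar>a\<bar> \<le> 1 \<and> \<bar>b\<bar> \<le> 1"
proof -
  obtain \<sigma> where s: "\<sigma> = 1 \<or> \<sigma> = -1" "\<bar>a\<bar> * \<sigma> = a"
      by (metis abs_if mult.right_neutral mult_minus1_right minus_minus)
  obtain \<tau> where t: "\<tau> = 1 \<or> \<tau> = -1" "\<bar>b\<bar> * \<tau> = b"
      by (metis abs_if mult.right_neutral mult_minus1_right minus_minus)
  have ts: "thin d W \<sigma> 0" "thin d W 0 \<tau>"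
    using s t in_square_thin_axes[OF W(2)] thin_uminus[of d W 1 0] thin_uminus[of d W 0 1] by auto
  show ?thesis
  proof (cases "\<bar>b\<bar> \<le> \<bar>a\<bar>")
    case True
    have D: "\<bar>\<sigma> * \<tau> - 0 * 0\<bar> = 1" using s t by auto
    obtain u v where B: "in_square d (aff \<sigma> 0 0 \<tau> u v ` W)" using thin_basis_in_square[OF W(1) ts D] .
    have "thin d (aff \<sigma> 0 0 \<tau> u v ` W) \<bar>a\<bar> \<bar>b\<bar>" using th s t by (simp add: thin_aff)
    then have "classifiable d (aff \<sigma> 0 0 \<tau> u v ` W) \<or> \<bar>a\<bar> = 1 \<and> \<bar>b\<bar> \<le> 1"
      by (rule in_square_thin_ordered[OF minimal_config_aff[OF D W(1)] B]) (use True ab in auto)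
    then show ?thesis using classifiable_aff[OF D] by (metis order_refl)
  next
    case False
    have D: "\<bar>0 * 0 - \<tau> * \<sigma>\<bar> = 1" using s t by auto
    obtain u v where B: "in_square d (aff 0 \<tau> \<sigma> 0 u v ` W)"
        using thin_basis_in_square[OF W(1) ts(2,1) D] .
    have "thin d (aff 0 \<tau> \<sigma> 0 u v ` W) \<bar>b\<bar> \<bar>a\<bar>" using th s t by (simp add: thin_aff)
    then have "classifiable d (aff 0 \<tau> \<sigma> 0 u v ` W) \<or> \<bar>b\<bar> = 1 \<and> \<bar>a\<bar> \<le> 1"
      by (rule in_square_thin_ordered[OF minimal_config_aff[OF D W(1)] B]) (use False ab in auto)
    then show ?thesis using classifiable_aff[OF D] by (metis order_refl)
  qed
qed

section \<open>Vertices on a square\<close>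

text \<open>For a set in the square that touches all four sides, this says that every point is alone
  on some side.\<close>

definition square_exposed :: "int \<Rightarrow> (int \<times> int) set \<Rightarrow> bool" where
  "square_exposed d W \<longleftrightarrow> (\<forall>r\<in>W. exposes d W 1 0 r \<or> exposes d W (-1) 0 r
     \<or> exposes d W 0 1 r \<or> exposes d W 0 (-1) r)"

lemma square_exposedE:
  assumes "square_exposed d W" "r \<in> W"
  obtains "\<And>p. p \<in> W \<Longrightarrow> p \<noteq> r \<Longrightarrow> fst r < fst p"
  | "\<And>p. p \<in> W \<Longrightarrow> p \<noteq> r \<Longrightarrow> fst p < fst r"
  | "\<And>p. p \<in> W \<Longrightarrow> p \<noteq> r \<Longrightarrow> snd r < snd p"
  | "\<And>p. p \<in> W \<Longrightarrow> p \<noteq> r \<Longrightarrow> snd p < snd r"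
proof -
  consider "exposes d W 1 0 r" | "exposes d W (-1) 0 r" | "exposes d W 0 1 r" | "exposes d W 0 (-1) r"
    using assms unfolding square_exposed_def by blast
  then show thesis using that by cases (auto simp: exposes_def ev_def)
qed

text \<open>The corner occupies the left and the bottom side at once, so every other point must be
  alone on the right or the top side. Wideness in direction (1, -1) then gives the inequality of
  (T1).\<close>

lemma square_corner_classifiable:
  assumes W: "minimal_config d W" "in_square d W" and ex: "square_exposed d W" and c: "(0, 0) \<in> W"
  shows "classifiable d W"
proof -
  obtain x1 y2 x2 y1 where P: "(x1, 0) \<in> W" "(d, y2) \<in> W" "(x2, d) \<in> W" "(0, y1) \<in> W"
    using in_square_sides[OF W] .
  have d: "1 \<le> d" using W by (simp add: minimal_config_def)
  have bd: "\<And>x y. (x, y) \<in> W \<Longrightarrow> 0 \<le> x \<and> x \<le> d \<and> 0 \<le> y \<and> y \<le> d"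
    using W(2) by (force simp: in_square_def)
  have sub: "r \<in> {(0, 0), (d, y2), (x2, d)}" if r: "r \<in> W" for r
  proof (rule ccontr)
    assume n: "r \<notin> {(0, 0), (d, y2), (x2, d)}"
    have b: "0 \<le> fst r" "fst r \<le> d" "0 \<le> snd r" "snd r \<le> d" using r W(2) by (auto simp: in_square_def)
    from ex r show False
      by (rule square_exposedE) (use c P n b in \<open>force+\<close>)
  qed
  have eq: "W = {(0, 0), (d, y2), (x2, d)}" using sub P c by blast
  obtain p q where "p \<in> W" "q \<in> W" "d \<le> ev 1 (-1) p - ev 1 (-1) q"
    using W(1) unfolding minimal_config_def wide_def by (metis prod.inject zero_neq_one)
  then have "x2 + y2 \<le> d" using bd[OF P(2)] bd[OF P(3)] d unfolding eq by (auto simp: ev_def)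
  then have "normal_form d W" unfolding normal_form_def eq using bd P
    by (intro disjI1 exI[of _ x2] exI[of _ y2]) auto
  then show ?thesis by (rule normal_form_imp_classifiable)
qed

lemma square_exposed_aff:
  assumes "\<bar>a * e - b * c\<bar> = 1"
    and "\<And>r. r \<in> V \<Longrightarrow> exposes d V a b r \<or> exposes d V (- a) (- b) r
      \<or> exposes d V c e r \<or> exposes d V (- c) (- e) r"
  shows "square_exposed d (aff a b c e s t ` V)"
  unfolding square_exposed_def using assms(2) by (auto simp: exposes_aff[OF assms(1)])

lemma square_any_corner_classifiable:
  assumes W: "minimal_config d W" "in_square d W" and ex: "square_exposed d W"
    and c: "(x, y) \<in> W" "x = 0 \<or> x = d" "y = 0 \<or> y = d"
  shows "classifiable d W"
proof -
  obtain a s where a: "a = 1 \<and> s = 0 \<or> a = -1 \<and> s = d" "a * x + s = 0"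
    using c(2) by force
  obtain e t where e: "e = 1 \<and> t = 0 \<or> e = -1 \<and> t = d" "e * y + t = 0"
    using c(3) by force
  have D: "\<bar>a * e - 0 * 0\<bar> = 1" using a e by auto
  have "classifiable d (aff a 0 0 e s t ` W)"
  proof (rule square_corner_classifiable)
    show "minimal_config d (aff a 0 0 e s t ` W)" using minimal_config_aff[OF D W(1)] .
    show "in_square d (aff a 0 0 e s t ` W)"
      using W(2) a e by (auto simp: in_square_def aff_def ev_def)
    show "square_exposed d (aff a 0 0 e s t ` W)"
      by (rule square_exposed_aff[OF D]) (use ex a e in \<open>auto simp: square_exposed_def\<close>)
    have "aff a 0 0 e s t (x, y) = (0, 0)" using a e by (simp add: aff_def ev_def)
    then show "(0, 0) \<in> aff a 0 0 e s t ` W" using c(1) by (metis imageI)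
  qed
  then show ?thesis using classifiable_aff[OF D] by blast
qed

lemma square_classifiable:
  assumes W: "minimal_config d W" "in_square d W" and ex: "square_exposed d W"
  shows "classifiable d W"
proof -
  obtain x1 y2 x2 y1 where P: "(x1, 0) \<in> W" "(d, y2) \<in> W" "(x2, d) \<in> W" "(0, y1) \<in> W"
    using in_square_sides[OF W] .
  have d: "1 \<le> d" using W by (simp add: minimal_config_def)
  have bd: "\<And>x y. (x, y) \<in> W \<Longrightarrow> 0 \<le> x \<and> x \<le> d \<and> 0 \<le> y \<and> y \<le> d"
    using W(2) by (force simp: in_square_def)
  have sub: "r \<in> {(x1, 0), (d, y2), (x2, d), (0, y1)}" if r: "r \<in> W" for r
  proof (rule ccontr)
    assume n: "r \<notin> {(x1, 0), (d, y2), (x2, d), (0, y1)}"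
    have b: "0 \<le> fst r" "fst r \<le> d" "0 \<le> snd r" "snd r \<le> d" using r W(2) by (auto simp: in_square_def)
    from ex r show False
      by (rule square_exposedE) (use P n b in \<open>force+\<close>)
  qed
  have eq: "W = {(x1, 0), (d, y2), (x2, d), (0, y1)}" using sub P by blast
  \<comment> \<open>Wideness in the two diagonal directions yields the two max-min inequalities of
    (T2).\<close>
  have W1: "\<exists>p\<in>W. \<exists>q\<in>W. d \<le> ev 1 1 p - ev 1 1 q" and W2: "\<exists>p\<in>W. \<exists>q\<in>W. d \<le> ev 1 (-1) p - ev 1 (-1) q"
    using W(1) unfolding minimal_config_def wide_def by (metis prod.inject zero_neq_one)+
  show ?thesis
  proof (cases "x1 \<in> {1..d-1} \<and> x2 \<in> {1..d-1} \<and> y1 \<in> {1..d-1} \<and> y2 \<in> {1..d-1}")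
    case True
    have "max x2 y2 \<ge> min x1 y1" using W1 True d unfolding eq by (auto simp: ev_def)
    moreover have "max (d - x2) y1 \<ge> min (d - x1) y2" using W2 True d unfolding eq
        by (auto simp: ev_def)
    ultimately have "normal_form d W" unfolding normal_form_def using True eq
      by (intro disjI2[OF disjI1] exI[of _ x1] exI[of _ x2] exI[of _ y1] exI[of _ y2]) simp
    then show ?thesis by (rule normal_form_imp_classifiable)
  next
    case False
    then have "(x1 = 0 \<or> x1 = d) \<or> (x2 = 0 \<or> x2 = d) \<or> (y1 = 0 \<or> y1 = d) \<or> (y2 = 0 \<or> y2 = d)"
      using bd P by (smt (verit) atLeastAtMost_iff)
    then show ?thesis using square_any_corner_classifiable[OF W ex] P by blast
  qed
qed

lemma square_basis_classifiable:
  assumes V: "minimal_config d V" and t: "thin d V a b" "thin d V c e" and D: "\<bar>a * e - b * c\<bar> = 1"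
    and ex: "\<And>r. r \<in> V \<Longrightarrow> exposes d V a b r \<or> exposes d V (- a) (- b) r
      \<or> exposes d V c e r \<or> exposes d V (- c) (- e) r"
  shows "classifiable d V"
proof -
  obtain s t where "in_square d (aff a b c e s t ` V)" using thin_basis_in_square[OF V t D] .
  then have "classifiable d (aff a b c e s t ` V)"
    using square_classifiable minimal_config_aff[OF D V] square_exposed_aff[OF D ex] by blast
  then show ?thesis using classifiable_aff[OF D] by blast
qed

section \<open>Vertices on a hexagon\<close>

text \<open>The lattice hexagon \<open>0 \<le> x, y \<le> l + m\<close>, \<open>- m \<le> x - y \<le> l\<close> has edges of lattice lengths
  \<open>l, m, l, m, l, m\<close>; \<open>a\<^sub>i\<close> is the distance of the \<open>i\<close>-th point from the start of the \<open>i\<close>-th edge,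
  counterclockwise from the bottom edge.\<close>

definition hexset :: "int \<Rightarrow> int \<Rightarrow> int \<Rightarrow> int \<Rightarrow> int \<Rightarrow> int \<Rightarrow> int \<Rightarrow> int \<Rightarrow> (int \<times> int) set" where
  "hexset l m a1 a2 a3 a4 a5 a6 = {(a1, 0), (l + a2, a2), (l + m, m + a3), (l + m - a4, l + m),
     (l - a5, l + m - a5), (0, m - a6)}"

definition inner_pos :: "int \<Rightarrow> int \<Rightarrow> bool" where
  "inner_pos n a \<longleftrightarrow> 0 < a \<and> a < n"

text \<open>A lattice rotation of order six (up to translation) carries each edge to the next and
  swaps \<open>l\<close> and \<open>m\<close>. Hence each normal form has to be matched in one
  position only.\<close>

lemma hexset_rotate:
  "aff 1 (-1) 1 0 m 0 ` hexset l m a1 a2 a3 a4 a5 a6 = hexset m l a6 a1 a2 a3 a4 a5"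
proof -
  have "aff 1 (-1) 1 0 m 0 ` hexset l m a1 a2 a3 a4 a5 a6 =
    {(m + a1, a1), (m + l, l + a2), (m + l - a3, m + l), (m - a4, m + l - a4), (0, l - a5), (a6, 0)}"
    by (simp add: hexset_def aff_def ev_def algebra_simps)
  also have "\<dots> = hexset m l a6 a1 a2 a3 a4 a5" unfolding hexset_def by blast
  finally show ?thesis .
qed

lemma classifiable_hexset_rotate:
  "classifiable d (hexset m l a6 a1 a2 a3 a4 a5) \<Longrightarrow> classifiable d (hexset l m a1 a2 a3 a4 a5 a6)"
  using classifiable_aff[of 1 0 "-1" 1] hexset_rotate
      by (metis abs_one diff_minus_eq_add add_0 mult_1 mult_minus_left mult_zero_right)

lemma hexset_inside_classifiable:
  assumes "inner_pos l a1" "inner_pos m a2" "inner_pos l a3" "inner_pos m a4" "inner_pos l a5"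
      "inner_pos m a6"
  shows "classifiable (l + m) (hexset l m a1 a2 a3 a4 a5 a6)"
proof (rule normal_form_imp_classifiable)
  show "normal_form (l + m) (hexset l m a1 a2 a3 a4 a5 a6)"
    unfolding normal_form_def hexset_def
    \<comment> \<open>Edges 4, 5 and 6 are traversed against the coordinates used in (T5), so
      \<open>a4\<close>, \<open>a5\<close> and \<open>a6\<close> enter as complements.\<close>
    by (intro disjI2, rule exI[of _ l], rule exI[of _ a1], rule exI[of _ "m - a4"],
        rule exI[of _ "m - a6"], rule exI[of _ a3], rule exI[of _ "l - a5"], rule exI[of _ a2])
      (use assms in \<open>simp add: inner_pos_def algebra_simps\<close>)
qed

text \<open>\<open>a6 = m\<close> and \<open>a1 = 0\<close> put the sixth and the first point at the
  same corner \<open>(0, 0)\<close>; five points remain, as in (T4).\<close>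

lemma hexset_one_corner_classifiable:
  assumes "a6 = m" "a1 = 0" "inner_pos m a2" "inner_pos l a3" "inner_pos m a4" "inner_pos l a5"
  shows "classifiable (l + m) (hexset l m a1 a2 a3 a4 a5 a6)"
proof (rule normal_form_imp_classifiable)
  have H: "hexset l m a1 a2 a3 a4 a5 a6 = {(0, 0), (l + a2, a2), (l + m, m + a3), (l + m - a4, l + m),
     (l - a5, l + m - a5)}" using assms(1,2) by (auto simp: hexset_def)
  show "normal_form (l + m) (hexset l m a1 a2 a3 a4 a5 a6)"
    unfolding normal_form_def H
    by (rule disjI2, rule disjI2, rule disjI2, rule disjI1, rule exI[of _ l], rule exI[of _ "m - a4"],
        rule exI[of _ a3], rule exI[of _ "l - a5"], rule exI[of _ a2])
      (use assms in \<open>simp add: inner_pos_def algebra_simps\<close>)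
qed

text \<open>The sixth and the second point occupy both ends of the bottom edge, and the first point
  coincides with one of them. This is (T3).\<close>

lemma hexset_two_corners_classifiable:
  assumes "a6 = m" "a2 = 0" "a1 = 0 \<or> a1 = l" "inner_pos l a3" "inner_pos m a4" "inner_pos l a5"
  shows "classifiable (l + m) (hexset l m a1 a2 a3 a4 a5 a6)"
proof (rule normal_form_imp_classifiable)
  have H: "hexset l m a1 a2 a3 a4 a5 a6 = {(0, 0), (l, 0), (l + m, m + a3), (l + m - a4, l + m),
     (l - a5, l + m - a5)}" using assms(1-3) by (auto simp: hexset_def)
  show "normal_form (l + m) (hexset l m a1 a2 a3 a4 a5 a6)"
    unfolding normal_form_def H
    by (rule disjI2, rule disjI2, rule disjI1, rule exI[of _ l], rule exI[of _ "m - a4"],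
        rule exI[of _ a3], rule exI[of _ "l - a5"])
      (use assms in \<open>simp add: inner_pos_def algebra_simps\<close>)
qed

text \<open>Each direction is minimal along one edge of the hexagon, which carries the point of that
  number. Another point can lie there only as a neighbour at the common corner, and then it has to
  be the same point; hence the two implications. The upper bound in \<open>exposes\<close> is
  automatic, as the hexagon has width \<open>l + m\<close> in all three directions.\<close>

lemma hexset_exposes:
  fixes l m a1 a2 a3 a4 a5 a6 :: int
  assumes lm: "1 \<le> l" "1 \<le> m"
    and a: "0 \<le> a1" "a1 \<le> l" "0 \<le> a2" "a2 \<le> m" "0 \<le> a3" "a3 \<le> l" "0 \<le> a4" "a4 \<le> m"
       "0 \<le> a5" "a5 \<le> l" "0 \<le> a6" "a6 \<le> m"
  defines "d \<equiv> l + m" and "H \<equiv> hexset l m a1 a2 a3 a4 a5 a6"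
  assumes r: "r \<in> H"
  shows "exposes d H 0 1 r \<longleftrightarrow> r = (a1, 0) \<and> (a2 = 0 \<longrightarrow> a1 = l) \<and> (a6 = m \<longrightarrow> a1 = 0)"
    and "exposes d H (-1) 1 r \<longleftrightarrow> r = (l + a2, a2) \<and> (a3 = 0 \<longrightarrow> a2 = m) \<and> (a1 = l \<longrightarrow> a2 = 0)"
    and "exposes d H (-1) 0 r \<longleftrightarrow> r = (l + m, m + a3) \<and> (a4 = 0 \<longrightarrow> a3 = l) \<and> (a2 = m \<longrightarrow> a3 = 0)"
    and "exposes d H 0 (-1) r \<longleftrightarrow> r = (l + m - a4, l + m) \<and> (a5 = 0 \<longrightarrow> a4 = m) \<and> (a3 = l \<longrightarrow> a4 = 0)"
    and "exposes d H 1 (-1) r \<longleftrightarrow> r = (l - a5, l + m - a5) \<and> (a6 = 0 \<longrightarrow> a5 = l) \<and> (a4 = m \<longrightarrow> a5 = 0)"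
    and "exposes d H 1 0 r \<longleftrightarrow> r = (0, m - a6) \<and> (a1 = 0 \<longrightarrow> a6 = m) \<and> (a5 = l \<longrightarrow> a6 = 0)"
proof -
  obtain x y where xy: "r = (x, y)" by fastforce
  have r': "x = a1 \<and> y = 0 \<or> x = l + a2 \<and> y = a2 \<or> x = l + m \<and> y = m + a3 \<or> x = l + m - a4 \<and> y = l + m
    \<or> x = l - a5 \<and> y = l + m - a5 \<or> x = 0 \<and> y = m - a6"
    using r unfolding H_def hexset_def xy by simp
  note defs = exposes_def H_def d_def hexset_def ev_def xy ball_simps prod.sel prod.inject
  show "exposes d H 0 1 r \<longleftrightarrow> r = (a1, 0) \<and> (a2 = 0 \<longrightarrow> a1 = l) \<and> (a6 = m \<longrightarrow> a1 = 0)"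
    unfolding defs using lm a r' by (smt (verit))
  show "exposes d H (-1) 1 r \<longleftrightarrow> r = (l + a2, a2) \<and> (a3 = 0 \<longrightarrow> a2 = m) \<and> (a1 = l \<longrightarrow> a2 = 0)"
    unfolding defs using lm a r' by (smt (verit))
  show "exposes d H (-1) 0 r \<longleftrightarrow> r = (l + m, m + a3) \<and> (a4 = 0 \<longrightarrow> a3 = l) \<and> (a2 = m \<longrightarrow> a3 = 0)"
    unfolding defs using lm a r' by (smt (verit))
  show "exposes d H 0 (-1) r \<longleftrightarrow> r = (l + m - a4, l + m) \<and> (a5 = 0 \<longrightarrow> a4 = m) \<and> (a3 = l \<longrightarrow> a4 = 0)"
    unfolding defs using lm a r' by (smt (verit))
  show "exposes d H 1 (-1) r \<longleftrightarrow> r = (l - a5, l + m - a5) \<and> (a6 = 0 \<longrightarrow> a5 = l) \<and> (a4 = m \<longrightarrow> a5 = 0)"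
    unfolding defs using lm a r' by (smt (verit))
  show "exposes d H 1 0 r \<longleftrightarrow> r = (0, m - a6) \<and> (a1 = 0 \<longrightarrow> a6 = m) \<and> (a5 = l \<longrightarrow> a6 = 0)"
    unfolding defs using lm a r' by (smt (verit))
qed

text \<open>For the \<open>i\<close>-th point of the hexagon, \<open>s\<^sub>i\<close> and \<open>e\<^sub>i\<close> say that it is the start or the end of its edge,
  and \<open>c\<^sub>i\<close> that it is the only point on that edge. Each point has to own some edge, its own one or, at
  a corner, the adjacent one. The conclusion lists (T5), the rotations of (T4) and of (T3), and the three
  ways to do without one pair of parallel edges.\<close>

lemma hexagon_ownership:
  fixes s1 e1 c1 s2 e2 c2 s3 e3 c3 s4 e4 c4 s5 e5 c5 s6 e6 c6 :: bool
  assumes "\<not> (s1 \<and> e1)"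
    and "\<not> (s2 \<and> e2)"
    and "\<not> (s3 \<and> e3)"
    and "\<not> (s4 \<and> e4)"
    and "\<not> (s5 \<and> e5)"
    and "\<not> (s6 \<and> e6)"
    and "c1 \<longleftrightarrow> (s2 \<longrightarrow> e1) \<and> (e6 \<longrightarrow> s1)"
    and "c2 \<longleftrightarrow> (s3 \<longrightarrow> e2) \<and> (e1 \<longrightarrow> s2)"
    and "c3 \<longleftrightarrow> (s4 \<longrightarrow> e3) \<and> (e2 \<longrightarrow> s3)"
    and "c4 \<longleftrightarrow> (s5 \<longrightarrow> e4) \<and> (e3 \<longrightarrow> s4)"
    and "c5 \<longleftrightarrow> (s6 \<longrightarrow> e5) \<and> (e4 \<longrightarrow> s5)"
    and "c6 \<longleftrightarrow> (s1 \<longrightarrow> e6) \<and> (e5 \<longrightarrow> s6)"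
    and "c1 \<or> (e1 \<and> s2 \<and> c2) \<or> (s1 \<and> e6 \<and> c6)"
    and "c2 \<or> (e2 \<and> s3 \<and> c3) \<or> (s2 \<and> e1 \<and> c1)"
    and "c3 \<or> (e3 \<and> s4 \<and> c4) \<or> (s3 \<and> e2 \<and> c2)"
    and "c4 \<or> (e4 \<and> s5 \<and> c5) \<or> (s4 \<and> e3 \<and> c3)"
    and "c5 \<or> (e5 \<and> s6 \<and> c6) \<or> (s5 \<and> e4 \<and> c4)"
    and "c6 \<or> (e6 \<and> s1 \<and> c1) \<or> (s6 \<and> e5 \<and> c5)"
  shows "(\<not> s1 \<and> \<not> e1 \<and> \<not> s2 \<and> \<not> e2 \<and> \<not> s3 \<and> \<not> e3 \<and> \<not> s4 \<and> \<not> e4 \<and> \<not> s5 \<and> \<not> e5 \<and> \<not> s6 \<and> \<not> e6)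
    \<or> (e6 \<and> s1 \<and> \<not> s2 \<and> \<not> e2 \<and> \<not> s3 \<and> \<not> e3 \<and> \<not> s4 \<and> \<not> e4 \<and> \<not> s5 \<and> \<not> e5)
    \<or> (e1 \<and> s2 \<and> \<not> s3 \<and> \<not> e3 \<and> \<not> s4 \<and> \<not> e4 \<and> \<not> s5 \<and> \<not> e5 \<and> \<not> s6 \<and> \<not> e6)
    \<or> (e2 \<and> s3 \<and> \<not> s4 \<and> \<not> e4 \<and> \<not> s5 \<and> \<not> e5 \<and> \<not> s6 \<and> \<not> e6 \<and> \<not> s1 \<and> \<not> e1)
    \<or> (e3 \<and> s4 \<and> \<not> s5 \<and> \<not> e5 \<and> \<not> s6 \<and> \<not> e6 \<and> \<not> s1 \<and> \<not> e1 \<and> \<not> s2 \<and> \<not> e2)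
    \<or> (e4 \<and> s5 \<and> \<not> s6 \<and> \<not> e6 \<and> \<not> s1 \<and> \<not> e1 \<and> \<not> s2 \<and> \<not> e2 \<and> \<not> s3 \<and> \<not> e3)
    \<or> (e5 \<and> s6 \<and> \<not> s1 \<and> \<not> e1 \<and> \<not> s2 \<and> \<not> e2 \<and> \<not> s3 \<and> \<not> e3 \<and> \<not> s4 \<and> \<not> e4)
    \<or> (e6 \<and> s2 \<and> (s1 \<or> e1) \<and> \<not> s3 \<and> \<not> e3 \<and> \<not> s4 \<and> \<not> e4 \<and> \<not> s5 \<and> \<not> e5)
    \<or> (e1 \<and> s3 \<and> (s2 \<or> e2) \<and> \<not> s4 \<and> \<not> e4 \<and> \<not> s5 \<and> \<not> e5 \<and> \<not> s6 \<and> \<not> e6)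
    \<or> (e2 \<and> s4 \<and> (s3 \<or> e3) \<and> \<not> s5 \<and> \<not> e5 \<and> \<not> s6 \<and> \<not> e6 \<and> \<not> s1 \<and> \<not> e1)
    \<or> (e3 \<and> s5 \<and> (s4 \<or> e4) \<and> \<not> s6 \<and> \<not> e6 \<and> \<not> s1 \<and> \<not> e1 \<and> \<not> s2 \<and> \<not> e2)
    \<or> (e4 \<and> s6 \<and> (s5 \<or> e5) \<and> \<not> s1 \<and> \<not> e1 \<and> \<not> s2 \<and> \<not> e2 \<and> \<not> s3 \<and> \<not> e3)
    \<or> (e5 \<and> s1 \<and> (s6 \<or> e6) \<and> \<not> s2 \<and> \<not> e2 \<and> \<not> s3 \<and> \<not> e3 \<and> \<not> s4 \<and> \<not> e4)
    \<or> (((e1 \<and> s2 \<and> c2) \<or> (s1 \<and> e6 \<and> c6)) \<and> (c2 \<or> (e2 \<and> s3 \<and> c3)) \<and> (c3 \<or> (s3 \<and> e2 \<and> c2)) \<and> ((e4 \<and> s5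
        \<and> c5) \<or> (s4 \<and> e3 \<and> c3)) \<and> (c5 \<or> (e5 \<and> s6 \<and> c6)) \<and> (c6 \<or> (s6 \<and> e5 \<and> c5)))
    \<or> ((c1 \<or> (s1 \<and> e6 \<and> c6)) \<and> ((e2 \<and> s3 \<and> c3) \<or> (s2 \<and> e1 \<and> c1)) \<and> (c3 \<or> (e3 \<and> s4 \<and> c4)) \<and> (c4 \<or> (s4
        \<and> e3 \<and> c3)) \<and> ((e5 \<and> s6 \<and> c6) \<or> (s5 \<and> e4 \<and> c4)) \<and> (c6 \<or> (e6 \<and> s1 \<and> c1)))
    \<or> ((c1 \<or> (e1 \<and> s2 \<and> c2)) \<and> (c2 \<or> (s2 \<and> e1 \<and> c1)) \<and> ((e3 \<and> s4 \<and> c4) \<or> (s3 \<and> e2 \<and> c2)) \<and> (c4 \<or> (e4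
        \<and> s5 \<and> c5)) \<and> (c5 \<or> (s5 \<and> e4 \<and> c4)) \<and> ((e6 \<and> s1 \<and> c1) \<or> (s6 \<and> e5 \<and> c5)))"
  using assms by argo

text \<open>Neighbouring points meet only at their common corner and other pairs never meet, so
  ownership of edges is a Boolean matter of which points sit at corners. The actual offsets matter
  again only when a case is matched with a normal form.\<close>

lemma hexset_classifiable:
  fixes l m a1 a2 a3 a4 a5 a6 :: int
  assumes lm: "1 \<le> l" "1 \<le> m"
    and a: "0 \<le> a1" "a1 \<le> l" "0 \<le> a2" "a2 \<le> m" "0 \<le> a3" "a3 \<le> l" "0 \<le> a4" "a4 \<le> m"
       "0 \<le> a5" "a5 \<le> l" "0 \<le> a6" "a6 \<le> m"
  defines "d \<equiv> l + m" and "H \<equiv> hexset l m a1 a2 a3 a4 a5 a6"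
  assumes H: "minimal_config d H"
    and ex: "\<And>r. r \<in> H \<Longrightarrow> exposes d H 0 1 r \<or> exposes d H (-1) 1 r \<or> exposes d H (-1) 0 r
      \<or> exposes d H 0 (-1) r \<or> exposes d H 1 (-1) r \<or> exposes d H 1 0 r"
  shows "classifiable d H"
proof -
  define p1 where "p1 = (a1, 0 :: int)"
  define p2 where "p2 = (l + a2, a2)"
  define p3 where "p3 = (l + m, m + a3)"
  define p4 where "p4 = (l + m - a4, l + m)"
  define p5 where "p5 = (l - a5, l + m - a5)"
  define p6 where "p6 = (0 :: int, m - a6)"
  define s1 where "s1 \<longleftrightarrow> a1 = 0"
  define e1 where "e1 \<longleftrightarrow> a1 = l"
  define s2 where "s2 \<longleftrightarrow> a2 = 0"
  define e2 where "e2 \<longleftrightarrow> a2 = m"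
  define s3 where "s3 \<longleftrightarrow> a3 = 0"
  define e3 where "e3 \<longleftrightarrow> a3 = l"
  define s4 where "s4 \<longleftrightarrow> a4 = 0"
  define e4 where "e4 \<longleftrightarrow> a4 = m"
  define s5 where "s5 \<longleftrightarrow> a5 = 0"
  define e5 where "e5 \<longleftrightarrow> a5 = l"
  define s6 where "s6 \<longleftrightarrow> a6 = 0"
  define e6 where "e6 \<longleftrightarrow> a6 = m"
  define c1 where "c1 \<longleftrightarrow> (s2 \<longrightarrow> e1) \<and> (e6 \<longrightarrow> s1)"
  define c2 where "c2 \<longleftrightarrow> (s3 \<longrightarrow> e2) \<and> (e1 \<longrightarrow> s2)"
  define c3 where "c3 \<longleftrightarrow> (s4 \<longrightarrow> e3) \<and> (e2 \<longrightarrow> s3)"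
  define c4 where "c4 \<longleftrightarrow> (s5 \<longrightarrow> e4) \<and> (e3 \<longrightarrow> s4)"
  define c5 where "c5 \<longleftrightarrow> (s6 \<longrightarrow> e5) \<and> (e4 \<longrightarrow> s5)"
  define c6 where "c6 \<longleftrightarrow> (s1 \<longrightarrow> e6) \<and> (e5 \<longrightarrow> s6)"
  note pd = p1_def p2_def p3_def p4_def p5_def p6_def
  note sed = s1_def e1_def s2_def e2_def s3_def e3_def s4_def e4_def s5_def e5_def s6_def e6_def
  note cd = c1_def c2_def c3_def c4_def c5_def c6_def
  have H_eq: "H = {p1, p2, p3, p4, p5, p6}" unfolding H_def hexset_def pd by simp
  have iff1: "exposes d H 0 1 r \<longleftrightarrow> r = p1 \<and> c1" if "r \<in> H" for r
    using hexset_exposes(1)[OF lm a that[unfolded H_def]] unfolding H_def d_def pd cd sed .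
  have iff2: "exposes d H (-1) 1 r \<longleftrightarrow> r = p2 \<and> c2" if "r \<in> H" for r
    using hexset_exposes(2)[OF lm a that[unfolded H_def]] unfolding H_def d_def pd cd sed .
  have iff3: "exposes d H (-1) 0 r \<longleftrightarrow> r = p3 \<and> c3" if "r \<in> H" for r
    using hexset_exposes(3)[OF lm a that[unfolded H_def]] unfolding H_def d_def pd cd sed .
  have iff4: "exposes d H 0 (-1) r \<longleftrightarrow> r = p4 \<and> c4" if "r \<in> H" for r
    using hexset_exposes(4)[OF lm a that[unfolded H_def]] unfolding H_def d_def pd cd sed .
  have iff5: "exposes d H 1 (-1) r \<longleftrightarrow> r = p5 \<and> c5" if "r \<in> H" for r
    using hexset_exposes(5)[OF lm a that[unfolded H_def]] unfolding H_def d_def pd cd sed .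
  have iff6: "exposes d H 1 0 r \<longleftrightarrow> r = p6 \<and> c6" if "r \<in> H" for r
    using hexset_exposes(6)[OF lm a that[unfolded H_def]] unfolding H_def d_def pd cd sed .
  note iff = iff1 iff2 iff3 iff4 iff5 iff6
  have own: "r = p1 \<and> c1 \<or> r = p2 \<and> c2 \<or> r = p3 \<and> c3 \<or> r = p4 \<and> c4 \<or> r = p5 \<and> c5 \<or> r = p6 \<and> c6"
    if r: "r \<in> H" for r
    using ex[OF r] unfolding iff[OF r] .
  have eq: "p1 = p2 \<longleftrightarrow> e1 \<and> s2" "p2 = p3 \<longleftrightarrow> e2 \<and> s3" "p3 = p4 \<longleftrightarrow> e3 \<and> s4" "p4 = p5 \<longleftrightarrow> e4 \<and> s5"
      "p5 = p6 \<longleftrightarrow> e5 \<and> s6" "p6 = p1 \<longleftrightarrow> e6 \<and> s1"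
    unfolding pd sed using lm a by auto
  have ne: "p1 \<noteq> p3" "p2 \<noteq> p4" "p3 \<noteq> p5" "p4 \<noteq> p6" "p5 \<noteq> p1" "p6 \<noteq> p2" "p1 \<noteq> p4" "p2 \<noteq> p5" "p3 \<noteq> p6"
    unfolding pd using lm a by auto
  have nse: "\<not> (s1 \<and> e1)" "\<not> (s2 \<and> e2)" "\<not> (s3 \<and> e3)" "\<not> (s4 \<and> e4)" "\<not> (s5 \<and> e5)" "\<not> (s6 \<and> e6)"
    unfolding sed using lm by auto
  have g1: "c1 \<or> (e1 \<and> s2 \<and> c2) \<or> (s1 \<and> e6 \<and> c6)"
    using own[of p1] eq ne unfolding H_eq by (metis insertCI)
  have g2: "c2 \<or> (e2 \<and> s3 \<and> c3) \<or> (s2 \<and> e1 \<and> c1)"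
    using own[of p2] eq ne unfolding H_eq by (metis insertCI)
  have g3: "c3 \<or> (e3 \<and> s4 \<and> c4) \<or> (s3 \<and> e2 \<and> c2)"
    using own[of p3] eq ne unfolding H_eq by (metis insertCI)
  have g4: "c4 \<or> (e4 \<and> s5 \<and> c5) \<or> (s4 \<and> e3 \<and> c3)"
    using own[of p4] eq ne unfolding H_eq by (metis insertCI)
  have g5: "c5 \<or> (e5 \<and> s6 \<and> c6) \<or> (s5 \<and> e4 \<and> c4)"
    using own[of p5] eq ne unfolding H_eq by (metis insertCI)
  have g6: "c6 \<or> (e6 \<and> s1 \<and> c1) \<or> (s6 \<and> e5 \<and> c5)"
    using own[of p6] eq ne unfolding H_eq by (metis insertCI)
  have inside: "\<not> s1 \<Longrightarrow> \<not> e1 \<Longrightarrow> inner_pos l a1" "\<not> s2 \<Longrightarrow> \<not> e2 \<Longrightarrow> inner_pos m a2"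
      "\<not> s3 \<Longrightarrow> \<not> e3 \<Longrightarrow> inner_pos l a3" "\<not> s4 \<Longrightarrow> \<not> e4 \<Longrightarrow> inner_pos m a4" "\<not> s5 \<Longrightarrow> \<not> e5 \<Longrightarrow> inner_pos l a5"
      "\<not> s6 \<Longrightarrow> \<not> e6 \<Longrightarrow> inner_pos m a6"
    unfolding inner_pos_def sed using a by auto
  note r1 = classifiable_hexset_rotate
  note r2 = r1[OF r1]
  note r3 = r1[OF r2]
  note r4 = r1[OF r3]
  note r5 = r1[OF r4]
  \<comment> \<open>An odd number of rotations swaps \<open>l\<close> and \<open>m\<close>; those
    cases use this form of \<open>d\<close>.\<close>
  have d': "d = m + l" unfolding d_def by simp
  have thin: "thin d H 1 0" "thin d H 0 1" "thin d H 1 (-1)"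
    unfolding thin_def H_def hexset_def d_def ev_def using lm a by auto
  note result = hexagon_ownership[OF nse c1_def c2_def c3_def c4_def c5_def c6_def g1 g2 g3 g4 g5 g6]
  then show ?thesis
  proof (elim disjE)
    assume "\<not> s1 \<and> \<not> e1 \<and> \<not> s2 \<and> \<not> e2 \<and> \<not> s3 \<and> \<not> e3 \<and> \<not> s4 \<and> \<not> e4 \<and> \<not> s5 \<and> \<not> e5 \<and> \<not> s6 \<and> \<not> e6"
    then show ?thesis unfolding H_def d_def using inside by (intro hexset_inside_classifiable) blast+
  next
    assume "e6 \<and> s1 \<and> \<not> s2 \<and> \<not> e2 \<and> \<not> s3 \<and> \<not> e3 \<and> \<not> s4 \<and> \<not> e4 \<and> \<not> s5 \<and> \<not> e5"
    then show ?thesis unfolding H_def d_def using inside unfolding sed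
        by (intro hexset_one_corner_classifiable) blast+
  next
    assume "e1 \<and> s2 \<and> \<not> s3 \<and> \<not> e3 \<and> \<not> s4 \<and> \<not> e4 \<and> \<not> s5 \<and> \<not> e5 \<and> \<not> s6 \<and> \<not> e6"
    then show ?thesis unfolding H_def d' using inside unfolding sed
        by (intro r5[OF hexset_one_corner_classifiable]) blast+
  next
    assume "e2 \<and> s3 \<and> \<not> s4 \<and> \<not> e4 \<and> \<not> s5 \<and> \<not> e5 \<and> \<not> s6 \<and> \<not> e6 \<and> \<not> s1 \<and> \<not> e1"
    then show ?thesis unfolding H_def d_def using inside unfolding sed
        by (intro r4[OF hexset_one_corner_classifiable]) blast+
  next
    assume "e3 \<and> s4 \<and> \<not> s5 \<and> \<not> e5 \<and> \<not> s6 \<and> \<not> e6 \<and> \<not> s1 \<and> \<not> e1 \<and> \<not> s2 \<and> \<not> e2"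
    then show ?thesis unfolding H_def d' using inside unfolding sed
        by (intro r3[OF hexset_one_corner_classifiable]) blast+
  next
    assume "e4 \<and> s5 \<and> \<not> s6 \<and> \<not> e6 \<and> \<not> s1 \<and> \<not> e1 \<and> \<not> s2 \<and> \<not> e2 \<and> \<not> s3 \<and> \<not> e3"
    then show ?thesis unfolding H_def d_def using inside unfolding sed
        by (intro r2[OF hexset_one_corner_classifiable]) blast+
  next
    assume "e5 \<and> s6 \<and> \<not> s1 \<and> \<not> e1 \<and> \<not> s2 \<and> \<not> e2 \<and> \<not> s3 \<and> \<not> e3 \<and> \<not> s4 \<and> \<not> e4"
    then show ?thesis unfolding H_def d' using inside unfolding sed
        by (intro r1[OF hexset_one_corner_classifiable]) blast+
  next
    assume "e6 \<and> s2 \<and> (s1 \<or> e1) \<and> \<not> s3 \<and> \<not> e3 \<and> \<not> s4 \<and> \<not> e4 \<and> \<not> s5 \<and> \<not> e5"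
    then show ?thesis unfolding H_def d_def using inside unfolding sed
        by (intro hexset_two_corners_classifiable) blast+
  next
    assume "e1 \<and> s3 \<and> (s2 \<or> e2) \<and> \<not> s4 \<and> \<not> e4 \<and> \<not> s5 \<and> \<not> e5 \<and> \<not> s6 \<and> \<not> e6"
    then show ?thesis unfolding H_def d' using inside unfolding sed
        by (intro r5[OF hexset_two_corners_classifiable]) blast+
  next
    assume "e2 \<and> s4 \<and> (s3 \<or> e3) \<and> \<not> s5 \<and> \<not> e5 \<and> \<not> s6 \<and> \<not> e6 \<and> \<not> s1 \<and> \<not> e1"
    then show ?thesis unfolding H_def d_def using inside unfolding sed
        by (intro r4[OF hexset_two_corners_classifiable]) blast+
  next
    assume "e3 \<and> s5 \<and> (s4 \<or> e4) \<and> \<not> s6 \<and> \<not> e6 \<and> \<not> s1 \<and> \<not> e1 \<and> \<not> s2 \<and> \<not> e2"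
    then show ?thesis unfolding H_def d' using inside unfolding sed
        by (intro r3[OF hexset_two_corners_classifiable]) blast+
  next
    assume "e4 \<and> s6 \<and> (s5 \<or> e5) \<and> \<not> s1 \<and> \<not> e1 \<and> \<not> s2 \<and> \<not> e2 \<and> \<not> s3 \<and> \<not> e3"
    then show ?thesis unfolding H_def d_def using inside unfolding sed
        by (intro r2[OF hexset_two_corners_classifiable]) blast+
  next
    assume "e5 \<and> s1 \<and> (s6 \<or> e6) \<and> \<not> s2 \<and> \<not> e2 \<and> \<not> s3 \<and> \<not> e3 \<and> \<not> s4 \<and> \<not> e4"
    then show ?thesis unfolding H_def d' using inside unfolding sed
        by (intro r1[OF hexset_two_corners_classifiable]) blast+
  next
    \<comment> \<open>Every point owns an edge other than 1 and 4, so the basis (1, -1), (1, 0)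
      reduces to the square. The next two cases dispense with edges 2 and 5, and with 3 and
      6.\<close>
    assume c: "((e1 \<and> s2 \<and> c2) \<or> (s1 \<and> e6 \<and> c6)) \<and> (c2 \<or> (e2 \<and> s3 \<and> c3)) \<and> (c3 \<or> (s3 \<and> e2 \<and> c2))
        \<and> ((e4 \<and> s5 \<and> c5) \<or> (s4 \<and> e3 \<and> c3)) \<and> (c5 \<or> (e5 \<and> s6 \<and> c6)) \<and> (c6 \<or> (s6 \<and> e5 \<and> c5))"
    have "exposes d H 1 (-1) r \<or> exposes d H (-1) 1 r \<or> exposes d H 1 0 r \<or> exposes d H (-1) 0 r"
        if r: "r \<in> H" for r
      using c eq r[unfolded H_eq insert_iff empty_iff] unfolding iff[OF r] by (smt (verit))
    then show ?thesis using square_basis_classifiable[OF H thin(3,1)] by simp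
  next
    assume c: "(c1 \<or> (s1 \<and> e6 \<and> c6)) \<and> ((e2 \<and> s3 \<and> c3) \<or> (s2 \<and> e1 \<and> c1)) \<and> (c3 \<or> (e3 \<and> s4 \<and> c4))
        \<and> (c4 \<or> (s4 \<and> e3 \<and> c3)) \<and> ((e5 \<and> s6 \<and> c6) \<or> (s5 \<and> e4 \<and> c4)) \<and> (c6 \<or> (e6 \<and> s1 \<and> c1))"
    have "exposes d H 1 0 r \<or> exposes d H (-1) 0 r \<or> exposes d H 0 1 r \<or> exposes d H 0 (-1) r" if r:
        "r \<in> H" for r
      using c eq r[unfolded H_eq insert_iff empty_iff] unfolding iff[OF r] by (smt (verit))
    then show ?thesis using square_basis_classifiable[OF H thin(1,2)] by simp
  next
    assume c: "(c1 \<or> (e1 \<and> s2 \<and> c2)) \<and> (c2 \<or> (s2 \<and> e1 \<and> c1)) \<and> ((e3 \<and> s4 \<and> c4) \<or> (s3 \<and> e2 \<and> c2))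
        \<and> (c4 \<or> (e4 \<and> s5 \<and> c5)) \<and> (c5 \<or> (s5 \<and> e4 \<and> c4)) \<and> ((e6 \<and> s1 \<and> c1) \<or> (s6 \<and> e5 \<and> c5))"
    have "exposes d H 0 1 r \<or> exposes d H 0 (-1) r \<or> exposes d H 1 (-1) r \<or> exposes d H (-1) 1 r"
        if r: "r \<in> H" for r
      using c eq r[unfolded H_eq insert_iff empty_iff] unfolding iff[OF r] by (smt (verit))
    then show ?thesis using square_basis_classifiable[OF H thin(2,3)] by simp
  qed
qed

lemma hexagon_classifiable:
  assumes W: "minimal_config d W" "in_square d W" and t: "thin d W 1 (-1)"
    and ex: "\<And>r. r \<in> W \<Longrightarrow> exposes d W 0 1 r \<or> exposes d W (-1) 1 r \<or> exposes d W (-1) 0 r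
      \<or> exposes d W 0 (-1) r \<or> exposes d W 1 (-1) r \<or> exposes d W 1 0 r"
  shows "classifiable d W"
proof -
  obtain x1 y2 x2 y1 where P: "(x1, 0) \<in> W" "(d, y2) \<in> W" "(x2, d) \<in> W" "(0, y1) \<in> W"
    using in_square_sides[OF W] .
  have d: "1 \<le> d" using W by (simp add: minimal_config_def)
  obtain m' where m': "\<And>p. p \<in> W \<Longrightarrow> m' \<le> ev 1 (-1) p \<and> ev 1 (-1) p \<le> m' + d"
    "\<exists>p\<in>W. ev 1 (-1) p = m'" "\<exists>p\<in>W. ev 1 (-1) p = m' + d"
    using thin_range[OF W(1) t] by auto
  define l m where "l = m' + d" and "m = - m'"
  have dlm: "d = l + m" by (simp add: l_def m_def)
  obtain u1 v1 where P5: "(u1, v1) \<in> W" "u1 - v1 = - m" using m'(2) by (auto simp: ev_def m_def)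
  obtain u2 v2 where P2: "(u2, v2) \<in> W" "u2 - v2 = l" using m'(3) by (auto simp: ev_def l_def)
  have bd: "0 \<le> fst p" "fst p \<le> d" "0 \<le> snd p" "snd p \<le> d" "- m \<le> fst p - snd p" "fst p - snd p \<le> l"
    if "p \<in> W" for p
    using that W(2) m'(1)[OF that] by (auto simp: in_square_def ev_def l_def m_def)
  note b1 = bd[OF P(1), simplified] and b3 = bd[OF P(2), simplified] and b4 = bd[OF P(3), simplified]
    and b6 = bd[OF P(4), simplified] and b5 = bd[OF P5(1), simplified] and b2 = bd[OF P2(1), simplified]
  \<comment> \<open>One point on each of the six sides exhausts \<open>W\<close>: a further point
    would be exposed by one of the six directions, although the chosen point on that side already
    has the minimal value.\<close>
  have own: "W = {q1, q2, q3, q4, q5, q6}"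
    if q: "{q1, q2, q3, q4, q5, q6} \<subseteq> W" "snd q1 = 0" "fst q2 - snd q2 = l" "fst q3 = d" "snd q4 = d"
      "fst q5 - snd q5 = - m" "fst q6 = 0" for q1 q2 q3 q4 q5 q6
  proof -
    have "r \<in> {q1, q2, q3, q4, q5, q6}" if r: "r \<in> W" for r
    proof (rule ccontr)
      assume n: "r \<notin> {q1, q2, q3, q4, q5, q6}"
      have "\<not> exposes d W 0 1 r" "\<not> exposes d W (-1) 1 r" "\<not> exposes d W (-1) 0 r"
        "\<not> exposes d W 0 (-1) r" "\<not> exposes d W 1 (-1) r" "\<not> exposes d W 1 0 r"
        using q n bd[OF r] unfolding exposes_def ev_def by force+
      then show False using ex[OF r] by blast
    qed
    then show ?thesis using q(1) by blast
  qed
  have triangle: "normal_form d {(0, 0), (d, 0), (0, d)}"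
    unfolding normal_form_def using d by (intro disjI1 exI[of _ 0]) auto
  \<comment> \<open>If \<open>l\<close> or \<open>m\<close> vanishes, the strip cuts the square down
    to half of it, and \<open>W\<close> consists of the corners of that triangle.\<close>
  consider "l = 0" | "m = 0" | "1 \<le> l" "1 \<le> m" using b1 b6 by linarith
  then show ?thesis
  proof cases
    case 1
    then have "x1 = 0" "y2 = d" "u1 = 0" "v1 = d" using dlm b1 b3 b5 P5(2) by auto
    then have "W = {(0, 0), (0, 0), (d, d), (d, d), (0, d), (0, 0)}"
      using 1 dlm P P5 by (intro own) auto
    then have "aff 1 0 0 (-1) 0 d ` W = {(0, 0), (d, 0), (0, d)}"
      by (auto simp: aff_def ev_def)
    then show ?thesis using triangle normal_form_imp_classifiable classifiable_aff[of 1
        "-1" 0 0 d 0 d W] by simp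
  next
    case 2
    then have "y1 = 0" "x2 = d" "u2 = d" "v2 = 0" using dlm b6 b4 b2 P2(2) by auto
    then have "W = {(0, 0), (d, 0), (d, d), (d, d), (0, 0), (0, 0)}"
      using 2 dlm P P2 by (intro own) auto
    then have "aff (-1) 0 0 1 d 0 ` W = {(0, 0), (d, 0), (0, d)}"
      by (auto simp: aff_def ev_def)
    then show ?thesis using triangle normal_form_imp_classifiable classifiable_aff[of
        "-1" 1 0 0 d d 0 W] by simp
  next
    case 3
    have W': "W = hexset l m x1 v2 (y2 - m) (d - x2) (d - v1) (m - y1)"
      unfolding hexset_def using P P2 P5 dlm by (intro own) (auto simp: algebra_simps)
    show ?thesis
      using W(1) ex unfolding W' dlm
      by (intro hexset_classifiable) (use 3 b1 b2 b3 b4 b5 b6 P2(2) P5(2) dlm in auto)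
  qed
qed

section \<open>Combining square, diamond and hexagon\<close>

lemma in_square_exposing:
  assumes W: "minimal_config d W" "in_square d W" and r: "r \<in> W" and n: "\<not> classifiable d W"
  obtains a b where "exposes d W a b r" "thin d W a b"
    "(a, b) \<in> {(0, 1), (-1, 1), (-1, 0), (0, -1), (1, -1), (1, 0), (1, 1), (-1, -1)}"
proof -
  obtain a b where ab: "exposes d W a b r" using W r unfolding minimal_config_def by blast
  have d: "0 \<le> d" using W by (simp add: minimal_config_def)
  have t: "thin d W a b" using exposes_thin[OF d ab r] .
  have "(a, b) \<noteq> (0, 0)" using exposes_nonzero[OF W(1) r ab] .
  moreover from this have "\<bar>a\<bar> \<le> 1 \<and> \<bar>b\<bar> \<le> 1" using in_square_thin[OF W t] n by blast
  then have "a \<in> {-1, 0, 1}" "b \<in> {-1, 0, 1}" by auto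
  ultimately have "(a, b) \<in> {(0, 1), (-1, 1), (-1, 0), (0, -1), (1, -1), (1, 0), (1, 1), (-1, -1)}"
      by auto
  then show thesis using that ab t by blast
qed

text \<open>Without (1, 1) only the six hexagon directions can expose a vertex. If (1, -1) is thin
  the hexagon applies; if not, only the four axis directions remain.\<close>

lemma in_square_not_thin_diagonal_classifiable:
  assumes W: "minimal_config d W" "in_square d W" and t: "\<not> thin d W 1 1"
  shows "classifiable d W"
proof (rule ccontr)
  assume n: "\<not> classifiable d W"
  have t': "\<not> thin d W (-1) (-1)" using t thin_uminus[of d W 1 1] by simp
  have ex: "exposes d W 0 1 r \<or> exposes d W (-1) 1 r \<or> exposes d W (-1) 0 r
      \<or> exposes d W 0 (-1) r \<or> exposes d W 1 (-1) r \<or> exposes d W 1 0 r" if r: "r \<in> W" for r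
    by (rule in_square_exposing[OF W r n]) (use t t' in auto)
  show False
  proof (cases "thin d W 1 (-1)")
    case True
    then show False using hexagon_classifiable[OF W True ex] n by blast
  next
    case False
    have d: "0 \<le> d" using W by (simp add: minimal_config_def)
    have "\<not> thin d W (-1) 1" using False thin_uminus[of d W 1 "-1"] by simp
    then have "square_exposed d W"
      unfolding square_exposed_def using ex False exposes_thin[OF d] by blast
    then show False using square_classifiable[OF W] n by blast
  qed
qed

text \<open>If (1, 1) is the only thin diagonal, reflecting the second coordinate turns it into (1,
  -1).\<close>

lemma minimal_config_classifiable:
  assumes V: "minimal_config d V"
  shows "classifiable d V"
proof -
  obtain a b c e where t: "thin d V a b" "thin d V c e" and D: "\<bar>a * e - b * c\<bar> = 1"
    using thin_basis[OF V] .
  obtain s t where B: "in_square d (aff a b c e s t ` V)" (is "in_square d ?W")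
    using thin_basis_in_square[OF V t D] .
  have W: "minimal_config d ?W" using minimal_config_aff[OF D V] .
  have "classifiable d ?W"
  proof (cases "thin d ?W 1 1 \<and> thin d ?W 1 (-1)")
    case True
    then show ?thesis using diamond_classifiable[OF W B] by blast
  next
    case False
    show ?thesis
    proof (cases "thin d ?W 1 1")
      case True
      then have n: "\<not> thin d ?W 1 (-1)" using False by blast
      have t': "thin d ?W 1 0" "thin d ?W 0 (-1)"
        using in_square_thin_axes[OF B] thin_uminus[of d ?W 0 1] by auto
      have D': "\<bar>1 * (-1) - 0 * 0\<bar> = (1 :: int)" by simp
      obtain s' t' where B': "in_square d (aff 1 0 0 (-1) s' t' ` ?W)"
        using thin_basis_in_square[OF W t' D'] .
      have "\<not> thin d (aff 1 0 0 (-1) s' t' ` ?W) 1 1" using n by (simp add: thin_aff[of d 1 0 0 "-1"])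
      then show ?thesis
        using in_square_not_thin_diagonal_classifiable[OF minimal_config_aff[OF D' W] B'] classifiable_aff[OF D'] by blast
    next
      case False
      then show ?thesis using in_square_not_thin_diagonal_classifiable[OF W B] by blast
    qed
  qed
  then show ?thesis using classifiable_aff[OF D] by blast
qed

section \<open>Lattice width and unimodular maps\<close>

definition emb :: "int \<times> int \<Rightarrow> real \<times> real" where
  "emb p = pt (fst p) (snd p)"

lemma emb_Pair: "emb (a, b) = pt a b"
  by (simp add: emb_def)

lemma inj_emb: "inj emb"
  by (auto simp: inj_def emb_def pt_def prod_eq_iff)

lemma lattice_polygon_iff:
  "lattice_polygon P \<longleftrightarrow> (\<exists>S. finite S \<and> S \<noteq> {} \<and> P = convex hull (emb ` S))"
  unfolding lattice_polygon_def emb_def by (simp add: case_prod_unfold)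

lemma functional_emb:
  "fst (emb p) * real_of_int a + snd (emb p) * real_of_int b = real_of_int (ev a b p)"
  by (simp add: emb_def pt_def ev_def algebra_simps)

lemma functional_hull_le:
  assumes "\<And>p. p \<in> S \<Longrightarrow> real_of_int (ev a b p) \<le> c" "q \<in> convex hull (emb ` S)"
  shows "fst q * real_of_int a + snd q * real_of_int b \<le> c"
proof -
  have "convex hull (emb ` S) \<subseteq> {x. inner (real_of_int a, real_of_int b) x \<le> c}"
    using assms(1) by (intro hull_minimal convex_halfspace_le)
      (auto simp: inner_prod_def functional_emb mult.commute simp flip: functional_emb)
  then show ?thesis using assms(2) by (auto simp: inner_prod_def mult.commute)
qed

lemma functional_hull_ge:
  assumes "\<And>p. p \<in> S \<Longrightarrow> c \<le> real_of_int (ev a b p)" "q \<in> convex hull (emb ` S)"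
  shows "c \<le> fst q * real_of_int a + snd q * real_of_int b"
proof -
  have "ev (- a) (- b) p = - ev a b p" for p by (simp add: ev_def)
  then have "fst q * real_of_int (- a) + snd q * real_of_int (- b) \<le> - c"
    using assms(1) by (intro functional_hull_le[OF _ assms(2)]) simp
  then show ?thesis by simp
qed

text \<open>A linear functional takes its extreme values over a hull at generators, so real suprema
  and infima become integer values at points of \<open>S\<close>.\<close>

lemma lw_dir_hull:
  assumes "finite S" "S \<noteq> {}"
  obtains p q where "p \<in> S" "q \<in> S"
      "lw_dir (convex hull (emb ` S)) (a, b) = real_of_int (ev a b p - ev a b q)"
    "\<And>x y. x \<in> S \<Longrightarrow> y \<in> S \<Longrightarrow> real_of_int (ev a b x - ev a b y) \<le> lw_dir (convex hull (emb ` S)) (a, b)"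
proof -
  have "Max (ev a b ` S) \<in> ev a b ` S" "Min (ev a b ` S) \<in> ev a b ` S" using assms by auto
  then obtain p q where pq: "p \<in> S" "q \<in> S" "ev a b p = Max (ev a b ` S)" "ev a b q = Min (ev a b ` S)"
    by (metis imageE)
  have p: "ev a b x \<le> ev a b p" and q: "ev a b q \<le> ev a b x" if "x \<in> S" for x
    using that pq assms by auto
  let ?P = "convex hull (emb ` S)"
  have "(SUP q\<in>?P. fst q * real_of_int a + snd q * real_of_int b) = real_of_int (ev a b p)"
  proof (rule cSup_eq_maximum)
    show "real_of_int (ev a b p) \<in> (\<lambda>q. fst q * real_of_int a + snd q * real_of_int b) ` ?P"
      using pq(1) hull_subset[of "emb ` S" convex] by (intro image_eqI[of _ _
          "emb p"]) (auto simp: functional_emb)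
  qed (use functional_hull_le[of S a b] p in auto)
  moreover have "(INF q\<in>?P. fst q * real_of_int a + snd q * real_of_int b) = real_of_int (ev a b q)"
  proof (rule cInf_eq_minimum)
    show "real_of_int (ev a b q) \<in> (\<lambda>q. fst q * real_of_int a + snd q * real_of_int b) ` ?P"
      using pq(2) hull_subset[of "emb ` S" convex] by (intro image_eqI[of _ _
          "emb q"]) (auto simp: functional_emb)
  qed (use functional_hull_ge[of S _ a b] q in auto)
  ultimately have lw: "lw_dir ?P (a, b) = real_of_int (ev a b p - ev a b q)"
    by (simp add: lw_dir_def)
  show thesis
  proof (rule that[OF pq(1,2) lw])
    fix x y assume "x \<in> S" "y \<in> S"
    then show "real_of_int (ev a b x - ev a b y) \<le> lw_dir ?P (a, b)"
      unfolding lw using p[of x] q[of y] by linarith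
  qed
qed

text \<open>Supplies the lower bound without which the real \<open>INF\<close> over directions would
  carry no information.\<close>

lemma lw_dir_nonneg: "lattice_polygon P \<Longrightarrow> 0 \<le> lw_dir P v"
  unfolding lattice_polygon_iff
  by (cases v) (metis lw_dir_hull diff_self of_int_0)

lemma primitive_exists: "primitive (1, 0)"
  by (simp add: primitive_def)

lemma lw_le_lw_dir:
  assumes "lattice_polygon P" "primitive v"
  shows "lw P \<le> lw_dir P v"
  unfolding lw_def using assms lw_dir_nonneg[OF assms(1)]
  by (intro cINF_lower bdd_belowI[of _ 0]) auto

lemma lw_greatest: "(\<And>v. primitive v \<Longrightarrow> c \<le> lw_dir P v) \<Longrightarrow> c \<le> lw P"
  unfolding lw_def using primitive_exists by (intro cINF_greatest) auto

lemma lw_lessD: "lw P < c \<Longrightarrow> \<exists>v. primitive v \<and> lw_dir P v < c"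
  using lw_greatest[of c P] by (meson not_le)

lemma lw_point: "lw {emb p} = 0"
proof -
  have P: "{emb p} = convex hull (emb ` {p})" by simp
  have l: "lattice_polygon {emb p}" unfolding lattice_polygon_iff P by blast
  have "lw_dir {emb p} (1, 0) = 0" unfolding P
    by (rule lw_dir_hull[of "{p}" 1 0]) auto
  then have "lw {emb p} \<le> 0" using lw_le_lw_dir[OF l primitive_exists] by simp
  moreover have "0 \<le> lw {emb p}" using lw_dir_nonneg[OF l] by (intro lw_greatest)
  ultimately show ?thesis by simp
qed

lemma unimod_emb: "unimod_map a b c e s t (emb p) = emb (aff a b c e s t p)"
  by (simp add: unimod_map_def emb_def pt_def aff_def ev_def)

lemma unimod_hull:
  "unimod_map a b c e s t ` (convex hull (emb ` S)) = convex hull (emb ` aff a b c e s t ` S)"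
proof -
  define f where "f q = (of_int a * fst q + of_int b * snd q, of_int c * fst q + of_int e * snd q)"
    for q :: "real \<times> real"
  have lin: "linear f" by (rule linearI) (auto simp: f_def algebra_simps)
  have u: "unimod_map a b c e s t = (+) (of_int s, of_int t) \<circ> f"
    by (auto simp: unimod_map_def f_def fun_eq_iff)
  have "unimod_map a b c e s t ` (convex hull (emb ` S)) = convex hull (unimod_map a b c e s t ` emb ` S)"
    unfolding u image_comp[symmetric] convex_hull_linear_image[OF lin] convex_hull_translation ..
  also have "unimod_map a b c e s t ` emb ` S = emb ` aff a b c e s t ` S"
    by (simp add: image_image unimod_emb)
  finally show ?thesis .
qed

lemma lattice_polygon_unimod: "lattice_polygon P \<Longrightarrow> lattice_polygon (unimod_map a b c e s t ` P)"
  unfolding lattice_polygon_iff using unimod_hull by (metis finite_imageI image_is_empty)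

lemma primitive_pullback:
  assumes D: "\<bar>a * e - b * c\<bar> = 1" and "primitive (u, v)"
  shows "primitive (u * a + v * c, u * b + v * e)"
proof -
  let ?g = "gcd (u * a + v * c) (u * b + v * e)"
  obtain x y where xy: "u * a + v * c = ?g * x" "u * b + v * e = ?g * y"
    by (meson dvdE gcd_dvd1 gcd_dvd2)
  have "u * (a * e - b * c) = e * (u * a + v * c) - c * (u * b + v * e)"
    "v * (a * e - b * c) = a * (u * b + v * e) - b * (u * a + v * c)" by algebra+
  then have "?g dvd u * (a * e - b * c)" "?g dvd v * (a * e - b * c)"
    by (metis dvd_diff dvd_mult gcd_dvd1 gcd_dvd2)+
  then have "?g dvd u" "?g dvd v" using D by (auto simp: abs_eq_one_int)
  then have "?g dvd 1" using assms(2) by (metis gcd_greatest primitive_def fst_conv snd_conv)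
  then have "?g = 1" by simp
  then show ?thesis by (auto simp: primitive_def)
qed

text \<open>The image has in direction \<open>v\<close> the width of \<open>P\<close> in the
  pulled-back primitive direction. One inequality is enough, since it also applies to the inverse
  map.\<close>

lemma lw_unimod_ge:
  assumes D: "\<bar>a * e - b * c\<bar> = 1" and P: "lattice_polygon P"
  shows "lw P \<le> lw (unimod_map a b c e s t ` P)"
proof (rule lw_greatest)
  fix v assume v: "primitive v"
  obtain v1 v2 where v12: "v = (v1, v2)" by fastforce
  obtain S where S: "finite S" "S \<noteq> {}" "P = convex hull (emb ` S)"
    using P unfolding lattice_polygon_iff by blast
  let ?v = "(v1 * a + v2 * c, v1 * b + v2 * e)"
  have "lw P \<le> lw_dir P ?v" using lw_le_lw_dir[OF P] primitive_pullback[OF D] v unfolding v12 by blast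
  also obtain p q where pq: "p \<in> S" "q \<in> S" "lw_dir P ?v = real_of_int
      (ev (v1 * a + v2 * c) (v1 * b + v2 * e) p - ev (v1 * a + v2 * c) (v1 * b + v2 * e) q)"
    using lw_dir_hull[OF S(1,2)] S(3) by metis
  have "lw_dir P ?v = real_of_int (ev v1 v2 (aff a b c e s t p) - ev v1 v2 (aff a b c e s t q))"
    unfolding pq(3) ev_aff by simp
  also have "\<dots> \<le> lw_dir (unimod_map a b c e s t ` P) v"
    unfolding S(3) unimod_hull v12 using lw_dir_hull[of "aff a b c e s t ` S" v1 v2] S pq
    by (metis finite_imageI image_is_empty imageI)
  finally show "lw P \<le> lw_dir (unimod_map a b c e s t ` P) v" .
qed

lemma unimod_inverse:
  assumes D: "\<bar>a * e - b * c\<bar> = 1"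
  obtains a' b' c' e' s' t' where "\<bar>a' * e' - b' * c'\<bar> = 1"
    "\<And>q. unimod_map a' b' c' e' s' t' (unimod_map a b c e s t q) = q"
proof -
  define D where "D = a * e - b * c"
  have DD: "D * D = 1" "\<bar>D\<bar> = 1" using assms unfolding D_def[symmetric] abs_eq_one_int by auto
  have rDD: "real_of_int D * real_of_int D = 1" using DD(1) by (metis of_int_1 of_int_mult)
  \<comment> \<open>The inverse matrix is \<open>D\<close> times the adjugate, as \<open>D\<close>
    is its own inverse.\<close>
  let ?U = "unimod_map (D * e) (- D * b) (- D * c) (D * a) (D * (b * t - e * s)) (D * (c * s - a * t))"
  have "?U (unimod_map a b c e s t q) = (real_of_int D * real_of_int D * fst q, real_of_int D * real_of_int D * snd q)" for q
    unfolding unimod_map_def by (simp add: D_def algebra_simps)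
  then have "?U (unimod_map a b c e s t q) = q" for q unfolding rDD by simp
  moreover have "\<bar>D * e * (D * a) - - D * b * (- D * c)\<bar> = 1"
  proof -
    have "D * e * (D * a) - - D * b * (- D * c) = D * D * D" unfolding D_def by algebra
    then show ?thesis using DD by simp
  qed
  ultimately show thesis using that by blast
qed

text \<open>A proper lattice subpolygon of the image is pulled back to one of \<open>P\<close>,
  where minimality applies; the widths are compared once along the inverse map and once along the
  map itself.\<close>

lemma minimal_polygon_unimod:
  assumes D: "\<bar>a * e - b * c\<bar> = 1" and P: "minimal_polygon P"
  shows "minimal_polygon (unimod_map a b c e s t ` P)" (is "minimal_polygon (?T ` P)")
  unfolding minimal_polygon_def
proof (intro conjI allI impI)
  have lP: "lattice_polygon P" using P by (simp add: minimal_polygon_def)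
  show "lattice_polygon (?T ` P)" using lattice_polygon_unimod[OF lP] .
  obtain a' b' c' e' s' t' where D': "\<bar>a' * e' - b' * c'\<bar> = 1"
    and inv: "\<And>q. unimod_map a' b' c' e' s' t' (?T q) = q"
    by (rule unimod_inverse[OF D, where s = s and t = t]) blast
  let ?T' = "unimod_map a' b' c' e' s' t'"
  fix R assume R: "lattice_polygon R \<and> R \<subset> ?T ` P"
  have sub: "?T' ` R \<subset> P"
  proof
    show "?T' ` R \<subseteq> P" using R inv by force
    show "?T' ` R \<noteq> P"
    proof
      assume "?T' ` R = P"
      then have "?T ` P = (\<lambda>q. ?T (?T' q)) ` R" by (metis image_image)
      also have "\<dots> = (\<lambda>q. q) ` R"
      proof (rule image_cong)
        fix q assume "q \<in> R"
        then obtain x where "q = ?T x" using R by blast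
        then show "?T (?T' q) = q" by (simp only: inv)
      qed simp
      finally show False using R by simp
    qed
  qed
  have "lw R \<le> lw (?T' ` R)" using lw_unimod_ge[OF D'] R by blast
  also have "\<dots> < lw P" 
    using P sub lattice_polygon_unimod[of R a' b' c' e' s' t'] R unfolding minimal_polygon_def by meson
  also have "\<dots> \<le> lw (?T ` P)" using lw_unimod_ge[OF D lP] .
  finally show "lw R < lw (?T ` P)" .
qed

section \<open>Exposing directions of the vertices\<close>

text \<open>\<open>A / D\<close> and \<open>B / D\<close> are the barycentric weights of
  \<open>X\<close> and \<open>Y\<close>; clearing the denominator keeps the hypotheses in the
  integers.\<close>

lemma lattice_point_in_triangle:
  assumes "convex P" "emb r \<in> P" "emb X \<in> P" "emb Y \<in> P"
    and "0 < D" "0 \<le> A" "0 \<le> B" "A + B \<le> D"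
    and "D * (fst h - fst r) = A * (fst X - fst r) + B * (fst Y - fst r)"
    and "D * (snd h - snd r) = A * (snd X - snd r) + B * (snd Y - snd r)"
  shows "emb h \<in> P"
proof -
  define \<alpha> \<beta> where "\<alpha> = real_of_int A / real_of_int D" and "\<beta> = real_of_int B / real_of_int D"
  have D: "0 < real_of_int D" using assms by simp
  have "\<alpha> + \<beta> = real_of_int (A + B) / real_of_int D" by (simp add: \<alpha>_def \<beta>_def add_divide_distrib)
  also have "\<dots> \<le> 1" using assms(8) D by (simp only: divide_le_eq_1_pos of_int_le_iff)
  finally have "0 \<le> \<alpha>" "0 \<le> \<beta>" "0 \<le> 1 - \<alpha> - \<beta>"
    using assms by (simp_all add: \<alpha>_def \<beta>_def)
  moreover have "emb h = (1 - \<alpha> - \<beta>) *\<^sub>R emb r + \<alpha> *\<^sub>R emb X + \<beta> *\<^sub>R emb Y"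
  proof -
    have "real_of_int x = real_of_int y + \<alpha> * (real_of_int z - real_of_int y) + \<beta> * (real_of_int w - real_of_int y)"
      if "D * (x - y) = A * (z - y) + B * (w - y)" for x y z w
    proof -
      have "real_of_int D * (real_of_int x - real_of_int y)
        = real_of_int A * (real_of_int z - real_of_int y) + real_of_int B * (real_of_int w - real_of_int y)"
        using arg_cong[OF that, of real_of_int] by simp
      then have "real_of_int x - real_of_int y = (real_of_int A * (real_of_int z - real_of_int y)
          + real_of_int B * (real_of_int w - real_of_int y)) / real_of_int D"
        using D by (metis nonzero_mult_div_cancel_left less_irrefl)
      then show ?thesis by (simp add: \<alpha>_def \<beta>_def add_divide_distrib)
    qed
    from this[OF assms(9)] this[OF assms(10)] show ?thesis
      by (simp add: emb_def pt_def algebra_simps)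
  qed
  ultimately have "emb h \<in> convex hull {emb r, emb X, emb Y}"
    unfolding convex_hull_3 by (intro CollectI exI[of _ "1 - \<alpha> - \<beta>"] exI[of _ \<alpha>] exI[of _ \<beta>]) auto
  also have "\<dots> \<subseteq> P" using assms by (intro hull_minimal) auto
  finally show ?thesis .
qed

lemma unimodular_vanish:
  assumes "\<bar>u1 * w2 - u2 * w1\<bar> = (1 :: int)" "u1 * x + u2 * y = 0" "w1 * x + w2 * y = 0"
  shows "x = 0" "y = 0"
  using unimodular_pullback_nonzero[of u1 w2 w1 u2 x y] assms by (auto simp: mult.commute)

text \<open>In the coordinates \<open>(u, w)\<close> centred at \<open>r\<close> the points \<open>X\<close> and \<open>Y\<close> lie in the positive quadrant on
  different sides of the diagonal, so the triangle \<open>r, X, Y\<close> contains the point \<open>(1, 1)\<close>.\<close>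

lemma diagonal_point_in_polygon:
  assumes P: "convex P" "emb r \<in> P" "emb X \<in> P" "emb Y \<in> P"
    and D: "\<bar>u1 * w2 - u2 * w1\<bar> = 1"
    and X: "1 \<le> ev u1 u2 X - ev u1 u2 r" "ev u1 u2 X - ev u1 u2 r \<le> ev w1 w2 X - ev w1 w2 r"
    and Y: "1 \<le> ev w1 w2 Y - ev w1 w2 r" "ev w1 w2 Y - ev w1 w2 r \<le> ev u1 u2 Y - ev u1 u2 r"
  obtains h where "emb h \<in> P" "ev u1 u2 h - ev u1 u2 r = 1" "ev w1 w2 h - ev w1 w2 r = 1"
proof -
  define x1 x2 y1 y2 where "x1 = ev u1 u2 X - ev u1 u2 r" and "x2 = ev w1 w2 X - ev w1 w2 r"
    and "y1 = ev u1 u2 Y - ev u1 u2 r" and "y2 = ev w1 w2 Y - ev w1 w2 r"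
  note xy = x1_def x2_def y1_def y2_def
  have le: "1 \<le> x1" "x1 \<le> x2" "1 \<le> y2" "y2 \<le> y1" using X Y by (simp_all add: xy)
  have D': "\<bar>u1 * w2 - w1 * u2\<bar> = 1" using D by (simp add: mult.commute)
  obtain i j where ij: "i * u1 + j * u2 = 1" "i * w1 + j * w2 = 1"
    using unimodular_pushforward[OF D', of 1 1] .
  define h where "h = (fst r + i, snd r + j)"
  have h: "ev u1 u2 h - ev u1 u2 r = 1" "ev w1 w2 h - ev w1 w2 r = 1"
    using ij by (simp_all add: h_def ev_def algebra_simps)
  have key: "emb h \<in> P" if K: "0 < K" "0 \<le> A" "0 \<le> B" "A + B \<le> K"
    and "K = A * x1 + B * y1" "K = A * x2 + B * y2" for K A B
  proof (rule lattice_point_in_triangle[OF P K])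
    define p q where "p = K * (fst h - fst r) - A * (fst X - fst r) - B * (fst Y - fst r)"
      and "q = K * (snd h - snd r) - A * (snd X - snd r) - B * (snd Y - snd r)"
    have "u1 * p + u2 * q = K * (ev u1 u2 h - ev u1 u2 r) - A * x1 - B * y1"
      "w1 * p + w2 * q = K * (ev w1 w2 h - ev w1 w2 r) - A * x2 - B * y2"
      by (simp_all add: p_def q_def xy ev_def algebra_simps)
    then have "u1 * p + u2 * q = 0" "w1 * p + w2 * q = 0" unfolding h using that(5,6) by simp_all
    then have "p = 0" "q = 0" using unimodular_vanish[OF D] by blast+
    then show "K * (fst h - fst r) = A * (fst X - fst r) + B * (fst Y - fst r)"
      "K * (snd h - snd r) = A * (snd X - snd r) + B * (snd Y - snd r)"
      by (simp_all add: p_def q_def)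
  qed
  have "emb h \<in> P"
  proof (cases "x1 = x2")
    case True
    then show ?thesis using key[of x1 1 0] le by simp
  next
    case False
    \<comment> \<open>By Cramer's rule the weights of \<open>X\<close> and \<open>Y\<close> are
      \<open>y1 - y2\<close> and \<open>x2 - x1\<close> over the determinant
      \<open>x2 * y1 - x1 * y2\<close>. The first two products add up to the determinant minus both
      weights, the last two to the determinant.\<close>
    have "0 \<le> (x2 - x1) * (y1 - 1)" "0 \<le> (x1 - 1) * (y1 - y2)" "0 < (x2 - x1) * y1" "0 \<le> x1 * (y1 - y2)"
      using le False by auto
    then have "0 < x2 * y1 - x1 * y2" "(y1 - y2) + (x2 - x1) \<le> x2 * y1 - x1 * y2"
      by (simp_all add: algebra_simps)
    moreover have "x2 * y1 - x1 * y2 = (y1 - y2) * x1 + (x2 - x1) * y1"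
      "x2 * y1 - x1 * y2 = (y1 - y2) * x2 + (x2 - x1) * y2" by algebra+
    ultimately show ?thesis using key[of "x2 * y1 - x1 * y2" "y1 - y2" "x2 - x1"] le by linarith
  qed
  then show thesis using that h by blast
qed

text \<open>Subtractive Euclidean descent on the basis \<open>(u, w)\<close> of directions, both positive on \<open>L\<close>: it stops
  as soon as the lattice point with coordinates \<open>(1, 1)\<close> belongs to \<open>L\<close>.\<close>

lemma exposing_descent:
  assumes P: "convex P" "emb r \<in> P" and L: "\<And>p. p \<in> L \<longleftrightarrow> emb p \<in> P \<and> p \<noteq> r" and X0: "X0 \<in> L"
    and f: "\<And>p q. p \<in> L \<Longrightarrow> q \<in> L \<Longrightarrow> ev f1 f2 p - ev f1 f2 q \<le> d - 1"
    and "\<bar>u1 * w2 - u2 * w1\<bar> = 1" "0 \<le> \<alpha>" "0 \<le> \<beta>" "0 < \<alpha> + \<beta>"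
    and "f1 = \<alpha> * u1 + \<beta> * w1" "f2 = \<alpha> * u2 + \<beta> * w2"
    and "\<And>p. p \<in> L \<Longrightarrow> 1 \<le> ev u1 u2 p - ev u1 u2 r"
    and "\<And>p. p \<in> L \<Longrightarrow> 1 \<le> ev w1 w2 p - ev w1 w2 r"
  shows "\<exists>a b. \<forall>p\<in>L. 1 \<le> ev a b p - ev a b r \<and> ev a b p - ev a b r \<le> d"
  using assms(6-)
proof (induction "nat (ev u1 u2 X0 - ev u1 u2 r + (ev w1 w2 X0 - ev w1 w2 r))"
    arbitrary: u1 u2 w1 w2 \<alpha> \<beta> rule: less_induct)
  case less
  define U W where "U p = ev u1 u2 p - ev u1 u2 r" and "W p = ev w1 w2 p - ev w1 w2 r" for p
  have pos: "1 \<le> U p" "1 \<le> W p" if "p \<in> L" for p using less.prems that by (auto simp: U_def W_def)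
  have fUW: "ev f1 f2 p - ev f1 f2 q = \<alpha> * (U p - U q) + \<beta> * (W p - W q)" for p q
    unfolding less.prems(5,6) U_def W_def by (simp add: ev_def algebra_simps)
  have diff: "ev (a - b) (c - e) p = ev a c p - ev b e p" for a b c e p
    by (simp add: ev_def algebra_simps)
  show ?case
  proof (cases "\<exists>h\<in>L. U h = 1 \<and> W h = 1")
    case True
    then obtain h where h: "h \<in> L" "U h = 1" "W h = 1" by blast
    \<comment> \<open>Since \<open>\<alpha>\<close> or \<open>\<beta>\<close> is at least 1, this
      bounds \<open>U\<close> or \<open>W\<close> by \<open>d\<close> on \<open>L\<close>, and that
      coordinate is the desired direction.\<close>
    have bound: "\<alpha> * (U p - 1) + \<beta> * (W p - 1) \<le> d - 1" if "p \<in> L" for p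
      using f[OF that h(1)] unfolding fUW h(2,3) .
    show ?thesis
    proof (cases "1 \<le> \<alpha>")
      case True
      have "U p \<le> d" if "p \<in> L" for p
      proof -
        have "1 * (U p - 1) \<le> \<alpha> * (U p - 1)" using True pos[OF that] by (intro mult_right_mono) auto
        also have "\<dots> \<le> \<alpha> * (U p - 1) + \<beta> * (W p - 1)" using less.prems(3) pos[OF that] by simp
        also have "\<dots> \<le> d - 1" using bound[OF that] by (simp add: add.commute)
        finally show ?thesis by simp
      qed
      then show ?thesis using pos unfolding U_def by blast
    next
      case False
      then have "1 \<le> \<beta>" using less.prems by linarith
      have "W p \<le> d" if "p \<in> L" for p
      proof -
        have "1 * (W p - 1) \<le> \<beta> * (W p - 1)" using \<open>1 \<le> \<beta>\<close> pos[OF that] by (intro mult_right_mono) auto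
        also have "\<dots> \<le> \<beta> * (W p - 1) + \<alpha> * (U p - 1)" using less.prems(2) pos[OF that] by simp
        also have "\<dots> \<le> d - 1" using bound[OF that] by (simp add: add.commute)
        finally show ?thesis by simp
      qed
      then show ?thesis using pos unfolding W_def by blast
    qed
  next
    case no: False
    \<comment> \<open>As long as (1, 1) is missing, all of \<open>L\<close> lies strictly on one
      side of the diagonal, so subtracting the smaller coordinate from the larger keeps both
      positive.\<close>
    have "(\<forall>p\<in>L. W p < U p) \<or> (\<forall>p\<in>L. U p < W p)"
    proof (rule ccontr)
      assume "\<not> ?thesis"
      then obtain X Y where XY: "X \<in> L" "U X \<le> W X" "Y \<in> L" "W Y \<le> U Y" by (meson not_le)
      have XYP: "emb X \<in> P" "emb Y \<in> P" using XY L by blast+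
      obtain h where h: "emb h \<in> P" "U h = 1" "W h = 1"
        using diagonal_point_in_polygon[OF P XYP less.prems(1)] XY pos unfolding U_def W_def by metis
      have "h \<noteq> r" using h(2) by (auto simp: U_def)
      then show False using no h L by blast
    qed
    then show ?thesis
    proof
      assume lt: "\<forall>p\<in>L. W p < U p"
      show ?thesis
      \<comment> \<open>The new coefficients come from \<alpha> u + \<beta> w = \<alpha> (u - w) +
        (\<alpha> + \<beta>) w, and the coordinate sum of \<open>X0\<close> drops by
        \<open>W X0\<close>, which is at least 1.\<close>
      proof (rule less.hyps[of "u1 - w1" "u2 - w2" w1 w2 \<alpha> "\<alpha> + \<beta>"])
        show "nat (ev (u1 - w1) (u2 - w2) X0 - ev (u1 - w1) (u2 - w2) r + (ev w1 w2 X0 - ev w1 w2 r))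
          < nat (ev u1 u2 X0 - ev u1 u2 r + (ev w1 w2 X0 - ev w1 w2 r))"
          using pos[OF X0] unfolding diff U_def W_def by simp
        have "(u1 - w1) * w2 - (u2 - w2) * w1 = u1 * w2 - u2 * w1" by algebra
        then show "\<bar>(u1 - w1) * w2 - (u2 - w2) * w1\<bar> = 1" using less.prems(1) by simp
        show "1 \<le> ev (u1 - w1) (u2 - w2) p - ev (u1 - w1) (u2 - w2) r" if "p \<in> L" for p
          using lt that unfolding diff U_def W_def by fastforce
      qed (use less.prems in \<open>auto simp: algebra_simps\<close>)
    next
      assume lt: "\<forall>p\<in>L. U p < W p"
      show ?thesis
      proof (rule less.hyps[of u1 u2 "w1 - u1" "w2 - u2" "\<alpha> + \<beta>" \<beta>])
        show "nat (ev u1 u2 X0 - ev u1 u2 r + (ev (w1 - u1) (w2 - u2) X0 - ev (w1 - u1) (w2 - u2) r))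
          < nat (ev u1 u2 X0 - ev u1 u2 r + (ev w1 w2 X0 - ev w1 w2 r))"
          using pos[OF X0] unfolding diff U_def W_def by simp
        have "u1 * (w2 - u2) - u2 * (w1 - u1) = u1 * w2 - u2 * w1" by algebra
        then show "\<bar>u1 * (w2 - u2) - u2 * (w1 - u1)\<bar> = 1" using less.prems(1) by simp
        show "1 \<le> ev (w1 - u1) (w2 - u2) p - ev (w1 - u1) (w2 - u2) r" if "p \<in> L" for p
          using lt that unfolding diff U_def W_def by fastforce
      qed (use less.prems in \<open>auto simp: algebra_simps\<close>)
    qed
  qed
qed

text \<open>Start of the descent: the given direction is the first basis vector, with coefficients 1
  and 0, and a Bezout complement becomes positive on the finite set \<open>L\<close> after adding a
  large multiple \<open>k\<close> of it.\<close>

lemma exposing_direction: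
  assumes P: "convex P" "emb r \<in> P" and L: "\<And>p. p \<in> L \<longleftrightarrow> emb p \<in> P \<and> p \<noteq> r"
    and fin: "finite L" "L \<noteq> {}" and prim: "gcd a b = 1"
    and pos: "\<And>p. p \<in> L \<Longrightarrow> ev a b r < ev a b p"
    and f: "\<And>p q. p \<in> L \<Longrightarrow> q \<in> L \<Longrightarrow> ev a b p - ev a b q \<le> d - 1"
  shows "\<exists>a b. \<forall>p\<in>L. 1 \<le> ev a b p - ev a b r \<and> ev a b p - ev a b r \<le> d"
proof -
  obtain X0 where X0: "X0 \<in> L" using fin by blast
  obtain u v where uv: "u * a + v * b = 1" using bezout_int[of a b] prim by auto
  define k where "k = 1 + (\<Sum>p\<in>L. \<bar>ev (- v) u p - ev (- v) u r\<bar>)"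
  have k: "1 \<le> k" unfolding k_def by (simp add: sum_nonneg)
  have w: "1 \<le> ev (- v + k * a) (u + k * b) p - ev (- v + k * a) (u + k * b) r" if p: "p \<in> L" for p
  proof -
    have "\<bar>ev (- v) u p - ev (- v) u r\<bar> \<le> k - 1"
      unfolding k_def using member_le_sum[OF p, of "\<lambda>p. \<bar>ev (- v) u p - ev (- v) u r\<bar>"] fin by simp
    moreover have "k * 1 \<le> k * (ev a b p - ev a b r)" using pos[OF p] k by (intro mult_left_mono) auto
    moreover have "ev (- v + k * a) (u + k * b) p - ev (- v + k * a) (u + k * b) r
      = (ev (- v) u p - ev (- v) u r) + k * (ev a b p - ev a b r)" by (simp add: ev_def algebra_simps)
    ultimately show ?thesis by linarith
  qed
  have "a * (u + k * b) - b * (- v + k * a) = u * a + v * b" by algebra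
  then have D: "\<bar>a * (u + k * b) - b * (- v + k * a)\<bar> = 1" using uv by simp
  show ?thesis
    by (rule exposing_descent[OF P L X0 f D, of 1 0]) (use pos w in \<open>force+\<close>)
qed

section \<open>From the polygon to its vertex set\<close>

lemma finite_lattice_points:
  assumes "finite S"
  shows "finite {p. emb p \<in> convex hull (emb ` S)}"
proof -
  have "bounded (convex hull (emb ` S))"
    using assms by (intro bounded_convex_hull finite_imp_bounded) simp
  then obtain B where B: "\<And>q. q \<in> convex hull (emb ` S) \<Longrightarrow> norm q \<le> B" unfolding bounded_iff by blast
  have "{p. emb p \<in> convex hull (emb ` S)} \<subseteq> {- \<lceil>B\<rceil>..\<lceil>B\<rceil>} \<times> {- \<lceil>B\<rceil>..\<lceil>B\<rceil>}"
  proof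
    fix p assume "p \<in> {p. emb p \<in> convex hull (emb ` S)}"
    then have "norm (emb p) \<le> B" using B by blast
    then have "\<bar>real_of_int (fst p)\<bar> \<le> B" "\<bar>real_of_int (snd p)\<bar> \<le> B"
      using norm_fst_le[of "fst (emb p)" "snd (emb p)"] norm_snd_le[of "snd (emb p)" "fst (emb p)"]
      by (auto simp: emb_def pt_def)
    then have "\<bar>fst p\<bar> \<le> \<lceil>B\<rceil>" "\<bar>snd p\<bar> \<le> \<lceil>B\<rceil>" by linarith+
    then show "p \<in> {- \<lceil>B\<rceil>..\<lceil>B\<rceil>} \<times> {- \<lceil>B\<rceil>..\<lceil>B\<rceil>}" by (auto simp: mem_Times_iff)
  qed
  then show ?thesis by (rule finite_subset) simp
qed

lemma wide_of_lw:
  assumes V: "finite V" "V \<noteq> {}" and lw: "real_of_int d \<le> lw (convex hull (emb ` V))" and d: "0 \<le> d"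
  shows "wide d V"
  unfolding wide_def
proof (intro allI impI)
  fix a b :: int assume ab: "(a, b) \<noteq> (0, 0)"
  define g where "g = gcd a b"
  define a' b' where "a' = a div g" and "b' = b div g"
  have g: "1 \<le> g" using ab unfolding g_def by (smt (verit) gcd_pos_int prod.inject)
  have eq: "a = g * a'" "b = g * b'" by (simp_all add: a'_def b'_def g_def)
  have "gcd a' b' = 1" unfolding a'_def b'_def g_def using ab
      by (intro div_gcd_coprime[unfolded coprime_iff_gcd_eq_1]) auto
  then have "primitive (a', b')" unfolding primitive_def by auto
  moreover have "lattice_polygon (convex hull (emb ` V))" using V unfolding lattice_polygon_iff by blast
  ultimately have "real_of_int d \<le> lw_dir (convex hull (emb ` V)) (a', b')"
    using lw lw_le_lw_dir by (meson order_trans)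
  then obtain p q where pq: "p \<in> V" "q \<in> V" "d \<le> ev a' b' p - ev a' b' q"
    using lw_dir_hull[OF V, of a' b'] by (metis of_int_le_iff)
  have "1 * d \<le> g * (ev a' b' p - ev a' b' q)" using pq g d by (intro mult_mono) auto
  also have "\<dots> = ev a b p - ev a b q" unfolding eq by (simp add: ev_def algebra_simps)
  finally show "\<exists>p\<in>V. \<exists>q\<in>V. d \<le> ev a b p - ev a b q" using pq by auto
qed

text \<open>Minkowski's theorem: the hull is generated by its extreme points, and these are lattice
  points because they lie among the generators.\<close>

lemma polygon_vertices:
  assumes "finite S" "S \<noteq> {}" "P = convex hull (emb ` S)"
  obtains V where "finite V" "V \<noteq> {}" "P = convex hull (emb ` V)" "\<And>r. r \<in> V \<Longrightarrow> emb r extreme_point_of P"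
proof -
  define V where "V = {p \<in> S. emb p extreme_point_of P}"
  have "compact P" unfolding assms(3) using assms(1) by (intro finite_imp_compact_convex_hull) simp
  then have "P = convex hull {x. x extreme_point_of P}"
    using assms(3) by (intro Krein_Milman_Minkowski) auto
  also have "{x. x extreme_point_of P} = emb ` V"
    unfolding V_def using extreme_point_of_convex_hull[of _ "emb ` S"] assms(3) by blast
  finally have P: "P = convex hull (emb ` V)" .
  moreover have "P \<noteq> {}" using assms by simp
  ultimately show thesis using that[of V] assms(1) unfolding V_def by fastforce
qed

text \<open>Removing the extreme point \<open>r\<close> leaves a convex set, so the hull of
  \<open>L\<close> is a proper subpolygon. A direction of width at most \<open>d - 1\<close> on
  \<open>L\<close> but at least \<open>d\<close> on \<open>V\<close> has \<open>r\<close> strictly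
  at one end; if it is the upper end, the direction is negated. \<open>L\<close> contains all
  lattice points other than \<open>r\<close>, not just the other vertices, because the descent needs
  the point (1, 1) to belong to it.\<close>

lemma minimal_polygon_vertices_minimal_config:
  assumes V: "finite V" "V \<noteq> {}" "P = convex hull (emb ` V)" "\<And>r. r \<in> V \<Longrightarrow> emb r extreme_point_of P"
    and P: "minimal_polygon P" "lw P = real_of_int d" and d: "1 \<le> d"
  shows "minimal_config d V"
proof -
  have wide: "wide d V" using wide_of_lw[OF V(1,2)] P(2) V(3) d by simp
  have cP: "convex P" using V(3) by simp
  have VP: "emb p \<in> P" if "p \<in> V" for p using V(3) that by (simp add: hull_inc)
  have "\<exists>a b. exposes d V a b r" if r: "r \<in> V" for r
  proof -
    define L where "L = {p. emb p \<in> P \<and> p \<noteq> r}"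
    have finL: "finite L"
      using finite_lattice_points[OF V(1)] unfolding L_def V(3)[symmetric]
          by (rule rev_finite_subset) auto
    obtain p0 q0 where "p0 \<in> V" "q0 \<in> V" "d \<le> ev 1 0 p0 - ev 1 0 q0"
      using wide unfolding wide_def by (metis prod.inject zero_neq_one)
    then have "p0 \<noteq> q0" using d by auto
    then have neL: "L \<noteq> {}" using \<open>p0 \<in> V\<close> \<open>q0 \<in> V\<close> VP unfolding L_def by blast
    define R where "R = convex hull (emb ` L)"
    have lR: "lattice_polygon R" unfolding lattice_polygon_iff R_def using finL neL by blast
    have "emb ` L \<subseteq> P - {emb r}" unfolding L_def using inj_emb by (auto simp: inj_eq)
    moreover have "convex (P - {emb r})" using V(4)[OF r] extreme_point_of_stillconvex[OF cP] by blast
    ultimately have "R \<subseteq> P - {emb r}" unfolding R_def by (rule hull_minimal)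
    then have "R \<subset> P" using VP[OF r] by blast
    then have "lw R < real_of_int d" using P lR unfolding minimal_polygon_def by metis
    then obtain v where v: "primitive v" "lw_dir R v < real_of_int d" using lw_lessD by blast
    obtain a b where ab: "v = (a, b)" by fastforce
    have prim: "gcd a b = 1" "(a, b) \<noteq> (0, 0)" using v(1) unfolding ab primitive_def by auto
    have fL: "ev a b p - ev a b q \<le> d - 1" if "p \<in> L" "q \<in> L" for p q
    proof -
      have "real_of_int (ev a b p - ev a b q) \<le> lw_dir R v"
        unfolding ab R_def using lw_dir_hull[OF finL neL, of a b] that by metis
      then show ?thesis using v(2) by linarith
    qed
    obtain p q where pq: "p \<in> V" "q \<in> V" "d \<le> ev a b p - ev a b q"
      using wide prim(2) unfolding wide_def by blast
    have L_iff: "x \<in> L \<longleftrightarrow> emb x \<in> P \<and> x \<noteq> r" for x by (simp add: L_def)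
    have VL: "x \<in> L" if "x \<in> V" "x \<noteq> r" for x using that VP L_iff by blast
    have "\<exists>a b. \<forall>p\<in>L. 1 \<le> ev a b p - ev a b r \<and> ev a b p - ev a b r \<le> d"
    proof (cases "q = r")
      case True
      then have "p \<noteq> r" using pq d by auto
      then have pL: "p \<in> L" using pq VL by blast
      have "ev a b r < ev a b x" if "x \<in> L" for x using fL[OF pL that] pq(3) unfolding True by linarith
      then show ?thesis
        by (intro exposing_direction[OF cP VP[OF r] L_iff finL neL prim(1) _ fL])
    next
      case False
      then have qL: "q \<in> L" using pq VL by blast
      have "p = r"
      proof (rule ccontr)
        assume "p \<noteq> r"
        then show False using fL[OF VL[OF pq(1)] qL] pq by linarith
      qed
      have m: "ev (- a) (- b) x = - ev a b x" for x by (simp add: ev_def)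
      have pos: "ev (- a) (- b) r < ev (- a) (- b) x" if "x \<in> L" for x
        using fL[OF that qL] pq(3) unfolding m \<open>p = r\<close> by linarith
      have fL': "ev (- a) (- b) x - ev (- a) (- b) y \<le> d - 1" if "x \<in> L" "y \<in> L" for x y
        using fL[OF that(2,1)] unfolding m by linarith
      have prim': "gcd (- a) (- b) = 1" using prim(1) by simp
      show ?thesis
        by (rule exposing_direction[OF cP VP[OF r] L_iff finL neL prim' pos fL'])
    qed
    then obtain a b where "\<forall>p\<in>L. 1 \<le> ev a b p - ev a b r \<and> ev a b p - ev a b r \<le> d" by blast
    then have "exposes d V a b r" unfolding exposes_def using VL by fastforce
    then show ?thesis by blast
  qed
  then show ?thesis using wide d unfolding minimal_config_def by blast
qed

lemma minimal_polygon_classifiable: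
  assumes P: "minimal_polygon P" "lw P = real_of_int d"
  obtains V where "P = convex hull (emb ` V)" "classifiable d V"
proof -
  have lP: "lattice_polygon P" using P by (simp add: minimal_polygon_def)
  then obtain S where S: "finite S" "S \<noteq> {}" "P = convex hull (emb ` S)"
    unfolding lattice_polygon_iff by blast
  have "0 \<le> lw P" using lw_dir_nonneg[OF lP] by (intro lw_greatest)
  then have "0 \<le> d" using P by simp
  then consider "d = 0" | "1 \<le> d" by linarith
  then show thesis
  proof cases
    case 1
    \<comment> \<open>A single lattice point also has width 0, so minimality makes \<open>P\<close>
      that point, and for \<open>d = 0\<close> the triangle of (T1) collapses to it.\<close>
    obtain p where p: "p \<in> S" using S by blast
    have l: "lattice_polygon {emb p}" unfolding lattice_polygon_iff by (intro exI[of _ "{p}"]) simp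
    have "{emb p} \<subseteq> P" using p S(3) by (simp add: hull_inc)
    moreover have "\<not> {emb p} \<subset> P"
      using P l lw_point 1 unfolding minimal_polygon_def by (metis less_irrefl of_int_0)
    ultimately have "P = convex hull (emb ` {p})" by auto
    moreover have "classifiable d {p}"
    proof -
      have "aff 1 0 0 1 (- fst p) (- snd p) ` {p} = {(0, 0), (d, 0), (0, d)}"
        using 1 by (simp add: aff_def ev_def)
      moreover have "normal_form d {(0, 0), (d, 0), (0, d)}"
        unfolding normal_form_def using 1 by (intro disjI1 exI[of _ 0]) auto
      ultimately show ?thesis
        using classifiable_aff[of 1 1 0 0 d "- fst p" "- snd p" "{p}"] normal_form_imp_classifiable
            by simp
    qed
    ultimately show thesis using that by blast
  next
    case 2
    obtain V where V: "finite V" "V \<noteq> {}" "P = convex hull (emb ` V)"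
      "\<And>r. r \<in> V \<Longrightarrow> emb r extreme_point_of P" by (rule polygon_vertices[OF S]) blast
    show thesis using that[OF V(3)] minimal_config_classifiable[OF minimal_polygon_vertices_minimal_config[OF V P 2]] by blast
  qed
qed

theorem theorem2p4:
  fixes \<Delta> :: "(real \<times> real) set" and d :: int
  assumes "lattice_polygon \<Delta>" and "\<Delta> \<noteq> {}" and "minimal_polygon \<Delta>"
    and "lw \<Delta> = of_int d"
  shows "\<exists>Q. unimod_equiv \<Delta> Q \<and> minimal_polygon Q \<and>
    ((\<exists>x y. 0 \<le> x \<and> x \<le> d \<and> 0 \<le> y \<and> y \<le> d \<and> x + y \<le> d \<and>
        Q = convex hull {pt 0 0, pt d y, pt x d})
   \<or> (\<exists>x1 x2 y1 y2. x1 \<in> {1..d-1} \<and> x2 \<in> {1..d-1} \<and> y1 \<in> {1..d-1} \<and> y2 \<in> {1..d-1} \<and>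
        max x2 y2 \<ge> min x1 y1 \<and> max (d - x2) y1 \<ge> min (d - x1) y2 \<and>
        Q = convex hull {pt x1 0, pt d y2, pt x2 d, pt 0 y1})
   \<or> (\<exists>l x y z. l \<in> {2..d-2} \<and> x \<in> {1..d-l-1} \<and> y \<in> {1..l-1} \<and> z \<in> {1..l-1} \<and>
        Q = convex hull {pt 0 0, pt l 0, pt d (y + d - l), pt (x + l) d, pt z (z + d - l)})
   \<or> (\<exists>l x y z z'. l \<in> {2..d-2} \<and> y \<in> {1..l-1} \<and> z \<in> {1..l-1} \<and>
        x \<in> {1..d-l-1} \<and> z' \<in> {1..d-l-1} \<and>
        Q = convex hull {pt 0 0, pt (z' + l) z', pt d (y + d - l), pt (x + l) d, pt z (z + d - l)})
   \<or> (\<exists>l x1 x2 y1 y2 z1 z2. l \<in> {2..d-2} \<and>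
        x1 \<in> {1..l-1} \<and> y2 \<in> {1..l-1} \<and> z1 \<in> {1..l-1} \<and>
        x2 \<in> {1..d-l-1} \<and> y1 \<in> {1..d-l-1} \<and> z2 \<in> {1..d-l-1} \<and>
        Q = convex hull {pt x1 0, pt (z2 + l) z2, pt d (d - l + y2), pt (x2 + l) d,
                         pt z1 (z1 + d - l), pt 0 y1}))"
proof -
  obtain V where V: "\<Delta> = convex hull (emb ` V)" "classifiable d V" using minimal_polygon_classifiable[OF assms(3,4)] .
  obtain W where "affine_equiv V W" and normal_form: "normal_form d W" using V(2) unfolding classifiable_def by blast
  then obtain a b c e s t where D: "\<bar>a * e - b * c\<bar> = 1" and W: "W = aff a b c e s t ` V"
    unfolding affine_equiv_def by blast
  define Q where "Q = unimod_map a b c e s t ` \<Delta>"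
  have Q: "Q = convex hull (emb ` W)" unfolding Q_def V(1) W by (rule unimod_hull)
  show ?thesis
  proof (intro exI[of _ Q] conjI)
    show "unimod_equiv \<Delta> Q" unfolding unimod_equiv_def Q_def using D by blast
    show "minimal_polygon Q" unfolding Q_def by (rule minimal_polygon_unimod[OF D assms(3)])
  qed (use normal_form in \<open>unfold normal_form_def Q, elim disj_forward ex_forward conj_forward;
      (assumption | simp add: emb_Pair)\<close>)
qed

end
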